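(* Let $X$ be a real Banach space and let $T_1,T_2:X\rightrightarrows X^*$ be maximal monotone operators of type (D). Then their variational sum $T_1\mathop{+}_v T_2$ is representable.
   Context: Operators are identified with their graphs. For a maximal monotone $T:X\rightrightarrows X^*$, $\widetilde T=\{(x^{**},x^* )\in X^{**}\times X^*: \langle x^{**}-y, x^*-y^*\rangle\ge 0 \text{ for all }(y,y^* )\in T\}$. $T$ is of type (D) if every $(x^{**},x^* )\in\widetilde T$ is the weak$^*\times$strong limit of a bounded net in $T$. A monotone operator $T$ is representable if there is a convex, proper, lower semicontinuous $h:X\times X^*\to\mathbb{R}\cup\{+\infty\}$ with $h(x,x^* )\ge\langle x,x^*\rangle$ for all $(x,x^* )$ and $T=\{(x,x^* ): h(x,x^* )=\langle x,x^*\rangle\}$. With $J=\partial\frac12\|\cdot\|^2$, for $T$ of type (D) and $\lambda>0$ the Moreau-Yosida regularization is $T_\lambda=\{(x,x^* ): \exists\, z^{**}\in X^{**} \text{ with } x^*\in\widetilde T(z^{**}),\ 0\in\lambda x^*+\widetilde J(z^{**}-x)\}$, and $T_0=T$. The sequential lower limit of operators $S_n:X\rightrightarrows X^*$ is $\liminf S_n=\{(x,x^* ): \exists\,(y_n,y_n^* )\in S_n \text{ with } (y_n,y_n^* )\to(x,x^* ) \text{ in the strong}\times\text{strong topology}\}$. Let $\mathcal{I}=\{(\lambda_n,\mu_n)_n\subset\mathbb{R}^2: \lambda_n,\mu_n\ge 0,\ \lambda_n+\mu_n>0,\ \lambda_n,\mu_n\to 0\}$. The variational sum is $T_1\mathop{+}_v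 T_2=\bigcap_{\mathcal{I}}\liminf_n (T_{1,\lambda_n}+T_{2,\mu_n})$. *)

theory Defs
  imports "HOL-Analysis.Analysis" "HOL-Library.Extended_Real"
begin

type_synonym 'a dual = "'a \<Rightarrow>\<^sub>L real"
type_synonym 'a bidual = "('a \<Rightarrow>\<^sub>L real) \<Rightarrow>\<^sub>L real"

definition canon :: "'a::banach \<Rightarrow> 'a bidual" where
  "canon x = Blinfun (\<lambda>f. blinfun_apply f x)"

definition monotone_op :: "('a::banach \<times> 'a dual) set \<Rightarrow> bool" where
  "monotone_op T \<longleftrightarrow>
     (\<forall>(x, xs) \<in> T. \<forall>(y, ys) \<in> T. blinfun_apply (xs - ys) (x - y) \<ge> 0)"

definition maximal_monotone :: "('a::banach \<times> 'a dual) set \<Rightarrow> bool" where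
  "maximal_monotone T \<longleftrightarrow> monotone_op T \<and>
     (\<forall>S. monotone_op S \<and> T \<subseteq> S \<longrightarrow> S = T)"

(* pairing of bidual element z - y with dual element xs - ys *)
definition tilde :: "('a::banach \<times> 'a dual) set \<Rightarrow> ('a bidual \<times> 'a dual) set" where
  "tilde T = {(z, xs). \<forall>(y, ys) \<in> T.
      blinfun_apply z (xs - ys) - blinfun_apply (xs - ys) y \<ge> 0}"

(* Type (D): every element of tilde T is the weakstar-times-strong limit of a bounded net
  in T.  Nets are represented by proper filters on the graph (a bounded net eventually lies
  in a bounded subset of T). *)
definition type_D :: "('a::banach \<times> 'a dual) set \<Rightarrow> bool" where
  "type_D T \<longleftrightarrow> maximal_monotone T \<and>
     (\<forall>(z, xs) \<in> tilde T. \<exists>B F. B \<subseteq> T \<and> bounded B \<and> F \<noteq> bot \<and>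
        (\<forall>\<^sub>F p in F. p \<in> B) \<and>
        (\<forall>f. ((\<lambda>p. blinfun_apply f (fst p)) \<longlongrightarrow> blinfun_apply z f) F) \<and>
        ((\<lambda>p. snd p) \<longlongrightarrow> xs) F)"

definition subdiff :: "('a::banach \<Rightarrow> real) \<Rightarrow> ('a \<times> 'a dual) set" where
  "subdiff f = {(x, xs). \<forall>y. f y \<ge> f x + blinfun_apply xs (y - x)}"

definition duality_map :: "('a::banach \<times> 'a dual) set" where
  "duality_map = subdiff (\<lambda>x. (1/2) * (norm x)\<^sup>2)"

definition yosida :: "('a::banach \<times> 'a dual) set \<Rightarrow> real \<Rightarrow> ('a \<times> 'a dual) set" where
  "yosida T lam = (if lam = 0 then T else
     {(x, xs). \<exists>z. (z, xs) \<in> tilde T \<and> (z - canon x, - (lam *\<^sub>R xs)) \<in> tilde duality_map})"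

definition op_sum :: "('a::banach \<times> 'a dual) set \<Rightarrow> ('a \<times> 'a dual) set \<Rightarrow> ('a \<times> 'a dual) set" where
  "op_sum A B = {(x, a + b) | x a b. (x, a) \<in> A \<and> (x, b) \<in> B}"

definition lower_limit :: "(nat \<Rightarrow> ('a::banach \<times> 'a dual) set) \<Rightarrow> ('a \<times> 'a dual) set" where
  "lower_limit S = {(x, xs). \<exists>y ys. (\<forall>n. (y n, ys n) \<in> S n) \<and>
      y \<longlonglongrightarrow> x \<and> ys \<longlonglongrightarrow> xs}"

definition variational_sum ::
  "('a::banach \<times> 'a dual) set \<Rightarrow> ('a \<times> 'a dual) set \<Rightarrow> ('a \<times> 'a dual) set" where
  "variational_sum T1 T2 = {p. \<forall>l m :: nat \<Rightarrow> real.
      (\<forall>n. l n \<ge> 0 \<and> m n \<ge> 0 \<and> l n + m n > 0) \<and> l \<longlonglongrightarrow> 0 \<and> m \<longlonglongrightarrow> 0 \<longrightarrow>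
      p \<in> lower_limit (\<lambda>n. op_sum (yosida T1 (l n)) (yosida T2 (m n)))}"

definition convex_ereal :: "('b::real_vector \<Rightarrow> ereal) \<Rightarrow> bool" where
  "convex_ereal h \<longleftrightarrow> convex {(p, t::real). h p \<le> ereal t}"

definition proper_fun :: "('b \<Rightarrow> ereal) \<Rightarrow> bool" where
  "proper_fun h \<longleftrightarrow> (\<forall>p. h p \<noteq> -\<infinity>) \<and> (\<exists>p. h p \<noteq> \<infinity>)"

definition lsc_fun :: "('b::topological_space \<Rightarrow> ereal) \<Rightarrow> bool" where
  "lsc_fun h \<longleftrightarrow> (\<forall>c. closed {p. h p \<le> c})"

definition representable :: "('a::banach \<times> 'a dual) set \<Rightarrow> bool" where
  "representable T \<longleftrightarrow> monotone_op T \<and> (\<exists>h :: 'a \<times> 'a dual \<Rightarrow> ereal.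
     convex_ereal h \<and> proper_fun h \<and> lsc_fun h \<and>
     (\<forall>x xs. h (x, xs) \<ge> ereal (blinfun_apply xs x)) \<and>
     T = {(x, xs). h (x, xs) = ereal (blinfun_apply xs x)})"

end

theory Submission
  imports Defs
begin

text \<open>
  The variational sum is an intersection of lower limits of the operators
  \<open>S = T\<^sub>1\<^sub>,\<^sub>\<lambda> + T\<^sub>2\<^sub>,\<^sub>\<mu>\<close> with \<open>\<lambda> + \<mu> > 0\<close>.  Each such \<open>S\<close> is monotone and nearly solvable: for every
  \<open>(x, x*)\<close> and \<open>e > 0\<close> some \<open>(y, y*)\<close> in \<open>S\<close> satisfies
  \<open>|y - x|^2/2 + |y* - x*|^2/2 + <y - x, y* - x*> \<le> e\<close>.  At a point where the Fitzpatrick function of \<open>S\<close>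
  exceeds the pairing by at most \<open>d\<close>, the last term is at least \<open>- d\<close>, so \<open>S\<close> has points at distance
  \<open>O(sqrt (d + e))\<close>, uniformly in \<open>S\<close>.  Hence the intersection of the lower limits of the
  Fitzpatrick epigraphs is a closed convex epigraph that touches the pairing exactly on the
  variational sum.

  Near solvability follows by Fenchel duality from two facts: a convex function representing \<open>S\<close>
  dominates the pairing, and so does its conjugate on the bidual.  For an operator of type (D) the
  second fact is the existence of the approximating nets; it is inherited by
  \<open>T\<^sub>1\<^sub>,\<^sub>\<lambda> + B\<close> through the partial inf-convolution with the continuous function
  \<open>|u|^2/(2\<lambda>) + \<lambda>|a|^2/2\<close>.  Iterating the approximate minimisation yields exact contact points, and a
  weak-star cluster point, obtained directly from Hahn--Banach, shows that these lie in the operator.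
\<close>

subsection \<open>Hahn--Banach\<close>

text \<open>The dual of X x X* is X* x X**, so a Fenchel multiplier for a problem on the graph space
  has a bidual component, and primal infima need not be attained. This is why solvability is only
  claimed up to e, why the condition on conjugates ranges over the bidual, and why completeness has
  to supply the exact contact points. No qualification condition has to link the two operators:
  since at least one parameter is positive, one summand brings a quadratic coupling that is finite
  and continuous everywhere. The other summand may then be any maximal monotone operator whose
  Fitzpatrick function has a conjugate above the pairing, which also covers the parameter 0.
  Infinite values never enter the arithmetic, lower semicontinuous hulls become closures, and limits
  of functions become limits of sets.\<close>

definition sublinear :: "('a::real_vector \<Rightarrow> real) \<Rightarrow> bool" where
  "sublinear p \<longleftrightarrow> (\<forall>x y. p (x + y) \<le> p x + p y) \<and> (\<forall>r>0. \<forall>x. p (r *\<^sub>R x) = r * p x)"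

lemma sublinearD:
  assumes "sublinear p"
  shows "p (x + y) \<le> p x + p y" and "r > 0 \<Longrightarrow> p (r *\<^sub>R x) = r * p x"
    and "p 0 = 0" and "- p (- x) \<le> p x"
proof -
  show add: "p (x + y) \<le> p x + p y" for x y using assms by (auto simp: sublinear_def)
  show "r > 0 \<Longrightarrow> p (r *\<^sub>R x) = r * p x" using assms by (auto simp: sublinear_def)
  have "p (2 *\<^sub>R 0) = 2 * p 0" using assms unfolding sublinear_def by (metis zero_less_numeral)
  then show p0: "p 0 = 0" by simp
  show "- p (- x) \<le> p x" using add[of x "- x"] p0 by simp
qed

text \<open>The infimum is finite since a sublinear \<open>p\<close> below \<open>q\<close>
  satisfies \<open>p x \<ge> - p (- x) \<ge> - q (- x)\<close>. The chain condition serves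
  subadditivity: two members are replaced by the smaller one.\<close>

lemma sublinear_Inf_chain:
  assumes C: "C \<noteq> {}" "\<And>p. p \<in> C \<Longrightarrow> sublinear p \<and> (\<forall>x. p x \<le> q x)"
    and chain: "\<And>f g. f \<in> C \<Longrightarrow> g \<in> C \<Longrightarrow> (\<forall>x. f x \<le> g x) \<or> (\<forall>x. g x \<le> f x)"
  shows "sublinear (\<lambda>x. INF p\<in>C. p x)"
    and "\<And>p x. p \<in> C \<Longrightarrow> (INF p\<in>C. p x) \<le> p x"
proof -
  have bdd: "bdd_below ((\<lambda>p. p x) ` C)" for x
  proof (rule bdd_belowI2)
    fix p assume "p \<in> C"
    then have "- p (- x) \<le> p x" "p (- x) \<le> q (- x)" using C sublinearD(4) by blast+
    then show "- q (- x) \<le> p x" by linarith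
  qed
  show low: "\<And>p x. p \<in> C \<Longrightarrow> (INF p\<in>C. p x) \<le> p x"
    by (rule cINF_lower[OF bdd])
  let ?m = "\<lambda>x. INF p\<in>C. p x"
  show "sublinear ?m"
    unfolding sublinear_def
  proof (intro conjI allI impI)
    fix x y
    have "?m (x + y) - f x \<le> ?m y" if f: "f \<in> C" for f
    proof (rule cINF_greatest[OF C(1)])
      fix g assume g: "g \<in> C"
      obtain k where k: "k \<in> C" "k x \<le> f x" "k y \<le> g y"
        using chain[OF f g] f g by blast
      have "?m (x + y) \<le> k (x + y)" using low[OF k(1)] .
      also have "\<dots> \<le> k x + k y" using C(2)[OF k(1)] sublinearD(1) by blast
      finally show "?m (x + y) - f x \<le> g y" using k by linarith
    qed
    then have "?m (x + y) - ?m y \<le> f x" if "f \<in> C" for f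
      using that by (simp add: algebra_simps)
    then have "?m (x + y) - ?m y \<le> ?m x"
      by (intro cINF_greatest[OF C(1)])
    then show "?m (x + y) \<le> ?m x + ?m y" by linarith
  next
    fix r :: real and x assume r: "r > 0"
    have 1: "r' * ?m y \<le> ?m (r' *\<^sub>R y)" if r': "r' > 0" for r' y
    proof (rule cINF_greatest[OF C(1)])
      fix f assume f: "f \<in> C"
      have "f (r' *\<^sub>R y) = r' * f y" using C(2)[OF f] sublinearD(2) r' by blast
      then show "r' * ?m y \<le> f (r' *\<^sub>R y)" using low[OF f, of y] r' by simp
    qed
    have "inverse r * ?m (r *\<^sub>R x) \<le> ?m x" using 1[of "inverse r" "r *\<^sub>R x"] r by simp
    then have "?m (r *\<^sub>R x) \<le> r * ?m x" using r by (simp add: field_simps)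
    then show "?m (r *\<^sub>R x) = r * ?m x" using 1[OF r, of x] by linarith
  qed
qed

text \<open>The function \<open>f\<close> lowers \<open>p\<close> along the ray of \<open>y\<close>:
  it is a sublinear minorant of \<open>p\<close> with \<open>f x \<le> p (x + y) - p y\<close>.
  Minimality forces \<open>f = p\<close>, and this bound becomes the missing half of
  additivity.\<close>

lemma minimal_sublinear_additive:
  assumes p: "sublinear p"
    and min: "\<And>f. sublinear f \<Longrightarrow> (\<And>x. f x \<le> p x) \<Longrightarrow> f = p"
  shows "p (x + y) = p x + p y"
proof -
  define f where "f x = (INF s\<in>{0..}. p (x + s *\<^sub>R y) - s * p y)" for x
  have hom: "p (s *\<^sub>R z) = s * p z" if "s \<ge> 0" for s z
    using that sublinearD(2,3)[OF p] by (cases "s = 0") auto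
  have bdd: "bdd_below ((\<lambda>s. p (x + s *\<^sub>R y) - s * p y) ` {0..})" for x
  proof (rule bdd_belowI2)
    fix s :: real assume s: "s \<in> {0..}"
    have "s * p y = p ((x + s *\<^sub>R y) + (- x))" using hom s by simp
    also have "\<dots> \<le> p (x + s *\<^sub>R y) + p (- x)" by (rule sublinearD(1)[OF p])
    finally show "- p (- x) \<le> p (x + s *\<^sub>R y) - s * p y" by linarith
  qed
  have low: "f x \<le> p (x + s *\<^sub>R y) - s * p y" if "s \<ge> 0" for s x
    unfolding f_def using that by (intro cINF_lower[OF bdd]) auto
  have "sublinear f"
    unfolding sublinear_def
  proof (intro conjI allI impI)
    fix u v
    have "f (u + v) - (p (u + s *\<^sub>R y) - s * p y) \<le> f v" if s: "s \<in> {0..}" for s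
      unfolding f_def[of v]
    proof (rule cINF_greatest)
      fix s' :: real assume s': "s' \<in> {0..}"
      have "f (u + v) \<le> p ((u + s *\<^sub>R y) + (v + s' *\<^sub>R y)) - (s + s') * p y"
        using low[of "s + s'" "u + v"] s s' by (simp add: algebra_simps)
      also have "p ((u + s *\<^sub>R y) + (v + s' *\<^sub>R y)) \<le> p (u + s *\<^sub>R y) + p (v + s' *\<^sub>R y)"
        by (rule sublinearD(1)[OF p])
      finally show "f (u + v) - (p (u + s *\<^sub>R y) - s * p y) \<le> p (v + s' *\<^sub>R y) - s' * p y"
        by (simp add: algebra_simps)
    qed auto
    then have "f (u + v) - f v \<le> p (u + s *\<^sub>R y) - s * p y" if "s \<in> {0..}" for s
      using that by (simp add: algebra_simps)
    then have "f (u + v) - f v \<le> f u"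
      unfolding f_def[of u] by (intro cINF_greatest) auto
    then show "f (u + v) \<le> f u + f v" by linarith
  next
    fix r :: real and u assume r: "r > 0"
    have 1: "r' * f v \<le> f (r' *\<^sub>R v)" if r': "r' > 0" for r' v
      unfolding f_def[of "r' *\<^sub>R v"]
    proof (rule cINF_greatest)
      fix s :: real assume s: "s \<in> {0..}"
      have "r' * f v \<le> r' * (p (v + (s / r') *\<^sub>R y) - (s / r') * p y)"
        using low[of "s / r'" v] s r' by simp
      also have "\<dots> = p (r' *\<^sub>R (v + (s / r') *\<^sub>R y)) - s * p y"
        using r' sublinearD(2)[OF p, of r' "v + (s / r') *\<^sub>R y"] by (simp add: right_diff_distrib)
      also have "r' *\<^sub>R (v + (s / r') *\<^sub>R y) = r' *\<^sub>R v + s *\<^sub>R y"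
        using r' by (simp add: algebra_simps)
      finally show "r' * f v \<le> p (r' *\<^sub>R v + s *\<^sub>R y) - s * p y" .
    qed auto
    have "inverse r * f (r *\<^sub>R u) \<le> f u" using 1[of "inverse r" "r *\<^sub>R u"] r by simp
    then have "f (r *\<^sub>R u) \<le> r * f u" using r by (simp add: field_simps)
    then show "f (r *\<^sub>R u) = r * f u" using 1[OF r, of u] by linarith
  qed
  then have "f = p" using min low[of 0] by simp
  then have "p x \<le> p (x + y) - p y" using low[of 1 x] by simp
  then show ?thesis using sublinearD(1)[OF p, of x y] by linarith
qed

theorem Hahn_Banach_sublinear:
  fixes q :: "'a::real_vector \<Rightarrow> real"
  assumes q: "sublinear q"
  shows "\<exists>f. linear f \<and> (\<forall>x. f x \<le> q x)"
proof -
  define A where "A = {p. sublinear p \<and> (\<forall>x. p x \<le> q x)}"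
  \<comment> \<open>The order is reversed, so that the maximal element given by Zorn's lemma is a
    minimal sublinear function.\<close>
  define P where "P f g \<longleftrightarrow> (\<forall>x. g x \<le> f x)" for f g :: "'a \<Rightarrow> real"
  have "\<exists>m\<in>A. \<forall>a\<in>A. P m a \<longrightarrow> a = m"
  proof (rule predicate_Zorn)
    show "partial_order_on A (relation_of P A)"
      by (rule partial_order_on_relation_ofI) (auto simp: P_def fun_eq_iff intro: order_trans antisym)
    fix C assume C: "C \<in> Chains (relation_of P A)"
    then have CA: "C \<subseteq> A" using Chains_relation_of by blast
    have ch: "(\<forall>x. f x \<le> g x) \<or> (\<forall>x. g x \<le> f x)" if "f \<in> C" "g \<in> C" for f g
      using C that by (auto simp: Chains_def relation_of_def P_def)
    show "\<exists>u\<in>A. \<forall>a\<in>C. P a u"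
    proof (cases "C = {}")
      case True then show ?thesis using q by (auto simp: A_def)
    next
      case False
      have CC: "sublinear p \<and> (\<forall>x. p x \<le> q x)" if "p \<in> C" for p using CA that by (auto simp: A_def)
      have inf: "sublinear (\<lambda>x. INF p\<in>C. p x)" "\<And>p x. p \<in> C \<Longrightarrow> (INF p\<in>C. p x) \<le> p x"
        using sublinear_Inf_chain[of C q] False CC ch by blast+
      show ?thesis
      proof (intro bexI ballI)
        show "P a (\<lambda>x. INF p\<in>C. p x)" if "a \<in> C" for a
          using inf(2)[OF that] by (simp add: P_def)
        obtain p where p: "p \<in> C" using False by blast
        have "(INF p\<in>C. p x) \<le> q x" for x
          using inf(2)[OF p, of x] CC[OF p] order_trans by blast
        then show "(\<lambda>x. INF p\<in>C. p x) \<in> A" using inf(1) by (simp add: A_def)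
      qed
    qed
  qed
  then obtain m where m: "m \<in> A" "\<And>a. a \<in> A \<Longrightarrow> P m a \<Longrightarrow> a = m" by blast
  have sm: "sublinear m" using m by (simp add: A_def)
  have add: "m (x + y) = m x + m y" for x y
  proof (rule minimal_sublinear_additive[OF sm])
    fix f assume f: "sublinear f" "\<And>x. f x \<le> m x"
    then have "f \<in> A" using m(1) order_trans unfolding A_def by blast
    then show "f = m" using m(2) f(2) by (simp add: P_def)
  qed
  have "m (- x) = - m x" for x using add[of x "- x"] sublinearD(3)[OF sm] by simp
  then have "m (r *\<^sub>R x) = r * m x" for r x
    using sublinearD(2)[OF sm, of r x] sublinearD(2)[OF sm, of "- r" "- x"] sublinearD(3)[OF sm]
    by (cases r "0::real" rule: linorder_cases) auto
  then have "linear m" by (intro linearI) (simp_all add: add)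
  then show ?thesis using m(1) by (auto simp: A_def)
qed

lemma bounded_linear_if_bounded_above:
  fixes f :: "'a::real_normed_vector \<Rightarrow> real"
  assumes f: "linear f" and d: "d > 0" and M: "\<And>x. norm x \<le> d \<Longrightarrow> f x \<le> M"
  shows "bounded_linear f"
proof (rule bounded_linear_intro)
  interpret linear f by fact
  show "f (x + y) = f x + f y" for x y by (rule add)
  show "f (r *\<^sub>R x) = r *\<^sub>R f x" for r x by (rule scale)
  show "norm (f x) \<le> norm x * (M / d)" for x
  proof (cases "x = 0")
    case True then show ?thesis by (simp add: zero)
  next
    case False
    have "f ((d / norm x) *\<^sub>R x) \<le> M" "f ((- d / norm x) *\<^sub>R x) \<le> M"
      using False d by (auto intro!: M)
    then have "d / norm x * \<bar>f x\<bar> \<le> M" by (auto simp: scale neg abs_if)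
    then show ?thesis using False d by (simp add: field_simps)
  qed
qed

text \<open>The directional infimum \<open>q\<close> of the perturbed problem is sublinear; a linear minorant of it
  separates \<open>E\<close> from the hypograph of \<open>c - g\<close>.\<close>

theorem sandwich_functional:
  fixes E :: "('a::real_normed_vector \<times> real) set" and g :: "'a \<Rightarrow> real"
  assumes E: "convex E" "E \<noteq> {}"
    and g: "convex_on UNIV g" and cont: "isCont g 0"
    and c: "\<And>w t. (w, t) \<in> E \<Longrightarrow> c \<le> t + g w"
  shows "\<exists>l :: 'a \<Rightarrow>\<^sub>L real. \<forall>(w, t) \<in> E. \<forall>x. c \<le> t + l w - l x + g x"
proof -
  define I where "I = {(v, t, s). (v, t) \<in> E \<and> (s::real) > 0}"
  define r where "r w = (\<lambda>(v, t, s). (t + g (v + s *\<^sub>R w) - c) / s)" for w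
  define q where "q w = (INF i\<in>I. r w i)" for w
  obtain v0 t0 where e0: "(v0, t0) \<in> E" using E by auto
  then have I: "I \<noteq> {}" by (auto simp: I_def intro: exI[of _ "1::real"])
  have gc: "g (a *\<^sub>R x + b *\<^sub>R y) \<le> a * g x + b * g y" if "a \<ge> 0" "b \<ge> 0" "a + b = 1" for a b x y
    using g that unfolding convex_on_def by auto
  have Ec: "(a *\<^sub>R x + b *\<^sub>R y, a * t + b * u) \<in> E"
    if "a \<ge> 0" "b \<ge> 0" "a + b = 1" "(x, t) \<in> E" "(y, u) \<in> E" for a b x y t u
    using convexD[OF E(1) that(4,5,1-3)] by simp
  have bdd: "bdd_below (r w ` I)" for w
  proof (rule bdd_belowI2)
    fix i assume "i \<in> I"
    then obtain v t s where i: "i = (v, t, s)" "(v, t) \<in> E" "s > 0" by (auto simp: I_def)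
    \<comment> \<open>Since \<open>b = s * a\<close>, the direction \<open>w\<close> cancels in
      \<open>a (v + s w) + b (v0 - w) = a v + b v0\<close>. Convexity of \<open>E\<close> and
      \<open>g\<close> then gives a lower bound that does not depend on \<open>i\<close>.\<close>
    define a b where "a = 1 / (1 + s)" and "b = s / (1 + s)"
    have ab: "a \<ge> 0" "b \<ge> 0" "a + b = 1" using i by (auto simp: a_def b_def field_simps)
    have bs: "b = s * a" by (simp add: a_def b_def)
    have "c \<le> (a * t + b * t0) + g (a *\<^sub>R v + b *\<^sub>R v0)" using c Ec[OF ab i(2) e0] by blast
    also have "a *\<^sub>R v + b *\<^sub>R v0 = a *\<^sub>R (v + s *\<^sub>R w) + b *\<^sub>R (v0 - w)"
      by (simp add: bs algebra_simps)
    also have "g \<dots> \<le> a * g (v + s *\<^sub>R w) + b * g (v0 - w)" by (rule gc[OF ab])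
    finally have "c \<le> a * ((t + g (v + s *\<^sub>R w)) + s * (t0 + g (v0 - w)))"
      by (simp add: bs algebra_simps)
    then have "c \<le> ((t + g (v + s *\<^sub>R w)) + s * (t0 + g (v0 - w))) / (1 + s)"
      by (simp add: a_def)
    then have "c * (1 + s) \<le> (t + g (v + s *\<^sub>R w)) + s * (t0 + g (v0 - w))"
      using i(3) by (simp only: pos_le_divide_eq)
    then show "- (t0 + g (v0 - w) - c) \<le> r w i"
      using i(3) by (simp add: r_def i(1) field_simps)
  qed
  have low: "q w \<le> (t + g (v + s *\<^sub>R w) - c) / s" if "(v, t) \<in> E" "s > 0" for v t s w
    using cINF_lower[OF bdd[of w], of "(v, t, s)"] that by (simp add: q_def I_def r_def)
  have sub: "sublinear q"
    unfolding sublinear_def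
  proof (intro conjI allI impI)
    fix w1 w2
    have *: "q (w1 + w2) \<le> r w1 i + r w2 j" if ij: "i \<in> I" "j \<in> I" for i j
    proof -
      obtain v1 t1 s1 where i: "i = (v1, t1, s1)" "(v1, t1) \<in> E" "s1 > 0"
        using ij by (auto simp: I_def)
      obtain v2 t2 s2 where j: "j = (v2, t2, s2)" "(v2, t2) \<in> E" "s2 > 0"
        using ij by (auto simp: I_def)
      \<comment> \<open>The weights make both contributions travel equally far:
        \<open>a * s1 = b * s2 = s\<close>, so the combined quotient in direction
        \<open>w1 + w2\<close> has denominator \<open>s\<close>.\<close>
      define a b s where "a = s2 / (s1 + s2)" and "b = s1 / (s1 + s2)" and "s = s1 * s2 / (s1 + s2)"
      have ab: "a \<ge> 0" "b \<ge> 0" using i j by (auto simp: a_def b_def)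
      have "s1 + s2 \<noteq> 0" using i j by simp
      then have ab1: "a + b = 1" by (simp add: a_def b_def add_divide_distrib[symmetric])
      note ab = ab ab1
      have s: "s = a * s1" "s = b * s2" by (simp_all add: a_def b_def s_def)
      have s0: "s > 0" using i j by (simp add: s_def)
      have e: "(a *\<^sub>R v1 + b *\<^sub>R v2) + s *\<^sub>R (w1 + w2) = a *\<^sub>R (v1 + s1 *\<^sub>R w1) + b *\<^sub>R (v2 + s2 *\<^sub>R w2)"
        using s by (simp add: algebra_simps)
      have "q (w1 + w2) \<le> (a * t1 + b * t2 + g ((a *\<^sub>R v1 + b *\<^sub>R v2) + s *\<^sub>R (w1 + w2)) - c) / s"
        by (rule low[OF Ec[OF ab i(2) j(2)] s0])
      also have "\<dots> \<le> (a * t1 + b * t2 + (a * g (v1 + s1 *\<^sub>R w1) + b * g (v2 + s2 *\<^sub>R w2)) - (a + b) * c) / s"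
        unfolding e using gc[OF ab] s0 ab(3) by (intro divide_right_mono) auto
      also have "\<dots> = a * (t1 + g (v1 + s1 *\<^sub>R w1) - c) / s + b * (t2 + g (v2 + s2 *\<^sub>R w2) - c) / s"
        by (simp add: add_divide_distrib[symmetric] algebra_simps)
      also have "a * (t1 + g (v1 + s1 *\<^sub>R w1) - c) / s = r w1 i"
        using s0 i by (auto simp: s(1) r_def)
      also have "b * (t2 + g (v2 + s2 *\<^sub>R w2) - c) / s = r w2 j"
        using s0 j by (auto simp: s(2) r_def)
      finally show ?thesis .
    qed
    have "q (w1 + w2) - r w1 i \<le> q w2" if "i \<in> I" for i
      unfolding q_def[of w2] using *[OF that] by (intro cINF_greatest[OF I]) (simp add: algebra_simps)
    then have "q (w1 + w2) - q w2 \<le> r w1 i" if "i \<in> I" for i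
      using that by (simp add: algebra_simps)
    then have "q (w1 + w2) - q w2 \<le> q w1"
      unfolding q_def[of w1] by (intro cINF_greatest[OF I])
    then show "q (w1 + w2) \<le> q w1 + q w2" by linarith
  next
    fix k :: real and w assume k: "k > 0"
    have 1: "k * q w \<le> q (k *\<^sub>R w)" if k: "k > 0" for k w
      unfolding q_def[of "k *\<^sub>R w"]
    proof (rule cINF_greatest[OF I])
      fix i assume "i \<in> I"
      then obtain v t s where i: "i = (v, t, s)" "(v, t) \<in> E" "s > 0" by (auto simp: I_def)
      have "k * q w \<le> k * ((t + g (v + (s * k) *\<^sub>R w) - c) / (s * k))"
        using low[OF i(2), of "s * k" w] i k by (intro mult_left_mono) auto
      also have "\<dots> = r (k *\<^sub>R w) i" using i k by (simp add: r_def)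
      finally show "k * q w \<le> r (k *\<^sub>R w) i" .
    qed
    have "inverse k * q (k *\<^sub>R w) \<le> q w" using 1[of "inverse k" "k *\<^sub>R w"] k by simp
    then have "q (k *\<^sub>R w) \<le> k * q w" using k by (simp add: field_simps)
    then show "q (k *\<^sub>R w) = k * q w" using 1[OF k, of w] by linarith
  qed
  obtain f where f: "linear f" "\<And>x. f x \<le> q x" using Hahn_Banach_sublinear[OF sub] by blast
  interpret linear f by (rule f(1))
  \<comment> \<open>A step of length 1 in direction \<open>x - w\<close> leads from \<open>w\<close>
    exactly to \<open>x\<close>.\<close>
  have key: "c \<le> t + f w - f x + g x" if "(w, t) \<in> E" for w t x
    using f(2)[of "x - w"] low[OF that, of 1 "x - w"] by (simp add: diff)
  obtain d where d: "d > 0" "\<And>x. norm x < d \<Longrightarrow> \<bar>g x - g 0\<bar> < 1"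
    using cont[unfolded continuous_at_eps_delta] by (metis dist_norm diff_zero real_norm_def zero_less_one)
  have "bounded_linear f"
  proof (rule bounded_linear_if_bounded_above[OF f(1)])
    show "d / 2 > 0" using d by simp
    fix x :: 'a assume "norm x \<le> d / 2"
    then have "norm x < d" using d by linarith
    then show "f x \<le> t0 + f v0 + (g 0 + 1) - c" using key[OF e0, of x] d(2)[of x] by linarith
  qed
  then have "blinfun_apply (Blinfun f) = f" by (rule bounded_linear_Blinfun_apply)
  then show ?thesis
    using key by (intro exI[of _ "Blinfun f"]) auto
qed

subsection \<open>Convex epigraphs above the pairing\<close>

lemma canon_apply [simp]: "blinfun_apply (canon x) f = blinfun_apply f x"
  unfolding canon_def by (simp add: bounded_linear_Blinfun_apply blinfun.bounded_linear_left)

lemma blinfun_prod_split: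
  fixes l :: "('a::real_normed_vector \<times> 'b::real_normed_vector) \<Rightarrow>\<^sub>L real"
  obtains l1 :: "'a \<Rightarrow>\<^sub>L real" and l2 :: "'b \<Rightarrow>\<^sub>L real" where "\<And>x y. l (x, y) = l1 x + l2 y"
proof -
  have 1: "bounded_linear (\<lambda>x. l (x, 0))" and 2: "bounded_linear (\<lambda>y. l (0, y))"
    by (auto intro!: bounded_linear_intros bounded_linear_Pair)
  have "l (x, y) = l (x, 0) + l (0, y)" for x y
    using blinfun.add_right[of l "(x, 0)" "(0, y)"] by simp
  then have "l (x, y) = Blinfun (\<lambda>x. l (x, 0)) x + Blinfun (\<lambda>y. l (0, y)) y" for x y
    unfolding bounded_linear_Blinfun_apply[OF 1] bounded_linear_Blinfun_apply[OF 2] .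
  then show ?thesis by (rule that)
qed

lemma blinfun_eq_0_if_bounded_above:
  fixes f :: "'a::real_normed_vector \<Rightarrow>\<^sub>L real"
  assumes "\<And>x. f x \<le> C"
  shows "f = 0"
proof (rule blinfun_eqI)
  fix x
  have "f x = 0"
  proof (rule ccontr)
    assume ne: "f x \<noteq> 0"
    have "f (((C + 1) / f x) *\<^sub>R x) = C + 1" using ne by (simp add: blinfun.scaleR_right)
    then show False using assms[of "((C + 1) / f x) *\<^sub>R x"] by simp
  qed
  then show "f x = blinfun_apply 0 x" by simp
qed

lemma pairing_le_squares:
  fixes F :: "'a::real_normed_vector \<Rightarrow>\<^sub>L real"
  assumes "c > 0"
  shows "\<bar>F x\<bar> \<le> c / 2 * (norm x)\<^sup>2 + (norm F)\<^sup>2 / (2 * c)"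
proof -
  have "\<bar>F x\<bar> \<le> norm F * norm x" using norm_blinfun[of F x] by simp
  also have "\<dots> \<le> c / 2 * (norm x)\<^sup>2 + (norm F)\<^sup>2 / (2 * c)"
  proof -
    have "0 \<le> (c * norm x - norm F)\<^sup>2 / (2 * c)" using assms by simp
    also have "\<dots> = c / 2 * (norm x)\<^sup>2 + (norm F)\<^sup>2 / (2 * c) - norm F * norm x"
      using assms by (simp add: power2_diff field_simps power2_eq_square)
    finally show ?thesis by simp
  qed
  finally show ?thesis .
qed

lemma Fenchel_Young:
  fixes F :: "'a::real_normed_vector \<Rightarrow>\<^sub>L real"
  shows "F x \<le> (1/2) * (norm x)\<^sup>2 + (1/2) * (norm F)\<^sup>2" 
    and "- F x \<le> (1/2) * (norm x)\<^sup>2 + (1/2) * (norm F)\<^sup>2"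
  using pairing_le_squares[of 1 F x] by auto

text \<open>The infimum of \<open>c / 2 * (norm x)\<^sup>2 + f x\<close> is minus the conjugate
  value \<open>(norm f)\<^sup>2 / (2 * c)\<close>. It is only approached, because \<open>f\<close>
  need not attain its norm.\<close>

lemma quadratic_near_min:
  fixes f :: "'a::real_normed_vector \<Rightarrow>\<^sub>L real"
  assumes c: "c > 0" and e: "e > 0"
  shows "\<exists>x. c / 2 * (norm x)\<^sup>2 + f x \<le> - (norm f)\<^sup>2 / (2 * c) + e"
proof (rule ccontr)
  define K where "K = (norm f)\<^sup>2 / (2 * c) - e"
  assume "\<not> ?thesis"
  then have K: "- K < c / 2 * (norm x)\<^sup>2 + f x" for x by (auto simp: K_def not_le)
  from K[of 0] have K0: "K > 0" by simp
  \<comment> \<open>On a sphere of radius \<open>r\<close> the negated claim bounds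
    \<open>norm f\<close> by \<open>K / r + c * r / 2\<close>; this radius minimises that
    bound.\<close>
  define r where "r = sqrt (2 * K / c)"
  have r: "r > 0" "r\<^sup>2 = 2 * K / c" using K0 c by (auto simp: r_def)
  have "norm f \<le> 2 * K / r"
  proof (rule norm_blinfun_bound)
    show "0 \<le> 2 * K / r" using K0 r by simp
    fix x show "norm (f x) \<le> 2 * K / r * norm x"
    proof (cases "x = 0")
      case False
      have 1: "- K < c / 2 * r\<^sup>2 + s * (r / norm x) * f x" if "s\<^sup>2 = 1" for s
        using K[of "(s * (r / norm x)) *\<^sub>R x"] False that
        by (simp add: blinfun.scaleR_right power_mult_distrib power_divide)
      have "c / 2 * r\<^sup>2 = K" using r c by simp
      then have "- (2 * K) < (r / norm x) * f x" "(r / norm x) * f x < 2 * K"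
        using 1[of 1] 1[of "-1"] by auto
      then have "r / norm x * \<bar>f x\<bar> < 2 * K" by (auto simp: abs_if)
      then show ?thesis using False r by (simp add: field_simps)
    qed simp
  qed
  then have "(norm f)\<^sup>2 \<le> (2 * K / r)\<^sup>2" by (intro power_mono) auto
  also have "\<dots> = 2 * K * c" using r K0 c by (simp add: power_divide power2_eq_square field_simps)
  also have "\<dots> = (norm f)\<^sup>2 - 2 * c * e" using c by (simp add: K_def field_simps)
  finally show False using mult_pos_pos[OF c e] by simp
qed

lemma norm_sq_convex:
  fixes x y :: "'a::real_normed_vector"
  assumes "u \<ge> 0" "v \<ge> 0" "u + v = 1"
  shows "(norm (u *\<^sub>R x + v *\<^sub>R y))\<^sup>2 \<le> u * (norm x)\<^sup>2 + v * (norm y)\<^sup>2"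
proof -
  have "norm (u *\<^sub>R x + v *\<^sub>R y) \<le> u * norm x + v * norm y"
    using norm_triangle_ineq[of "u *\<^sub>R x" "v *\<^sub>R y"] assms by simp
  then have "(norm (u *\<^sub>R x + v *\<^sub>R y))\<^sup>2 \<le> (u * norm x + v * norm y)\<^sup>2"
    by (intro power_mono) auto
  also have "\<dots> = u * (norm x)\<^sup>2 + v * (norm y)\<^sup>2 - u * v * (norm x - norm y)\<^sup>2"
  proof -
    have v: "v = 1 - u" using assms by simp
    show ?thesis unfolding v by (simp add: power2_eq_square algebra_simps)
  qed
  also have "\<dots> \<le> u * (norm x)\<^sup>2 + v * (norm y)\<^sup>2" using assms by simp
  finally show ?thesis .
qed

lemma convex_on_norm_sq_affine:
  fixes h :: "'a::real_normed_vector \<Rightarrow> 'b::real_normed_vector"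
  assumes h: "\<And>u v x y. u + v = 1 \<Longrightarrow> h (u *\<^sub>R x + v *\<^sub>R y) = u *\<^sub>R h x + v *\<^sub>R h y"
    and c: "c \<ge> 0"
  shows "convex_on UNIV (\<lambda>x. c * (norm (h x))\<^sup>2)"
proof (rule convex_onI)
  fix t :: real and x y assume t: "0 < t" "t < 1"
  have "c * (norm (h ((1 - t) *\<^sub>R x + t *\<^sub>R y)))\<^sup>2 \<le> c * ((1 - t) * (norm (h x))\<^sup>2 + t * (norm (h y))\<^sup>2)"
    using h[of "1 - t" t x y] norm_sq_convex[of "1 - t" t "h x" "h y"] t c
    by (intro mult_left_mono) auto
  then show "c * (norm (h ((1 - t) *\<^sub>R x + t *\<^sub>R y)))\<^sup>2 \<le> (1 - t) * (c * (norm (h x))\<^sup>2) + t * (c * (norm (h y))\<^sup>2)"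
    by (simp add: algebra_simps)
qed auto

section \<open>Representing sets and approximate solvability\<close>

definition above_pairing :: "(('a::banach \<times> 'a dual) \<times> real) set \<Rightarrow> bool" where
  "above_pairing E \<longleftrightarrow> (\<forall>x xs t. ((x, xs), t) \<in> E \<longrightarrow> blinfun_apply xs x \<le> t)"

text \<open>For \<open>E\<close> the epigraph of \<open>h\<close>, this says that the conjugate of \<open>h\<close> dominates the pairing of
  the bidual with the dual.\<close>

definition dual_above_pairing :: "(('a::banach \<times> 'a dual) \<times> real) set \<Rightarrow> bool" where
  "dual_above_pairing E \<longleftrightarrow> (\<forall>z :: 'a bidual. \<forall>xs. \<forall>e>0. \<exists>y ys t. ((y, ys), t) \<in> E \<and>
     t - blinfun_apply z ys - blinfun_apply xs y \<le> - blinfun_apply z xs + e)"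

text \<open>The Fenchel-Young defect of \<open>y - x\<close> and \<open>xs - ys\<close>: it vanishes
  exactly when \<open>xs - ys\<close> belongs to the duality map J at \<open>y - x\<close>. Near
  solvability is thus the approximate version of the range condition that \<open>xs\<close> lies in
  \<open>S y + J (y - x)\<close> for some \<open>y\<close>; the exact version need not hold without
  reflexivity.\<close>

definition gap :: "'a::banach \<Rightarrow> 'a dual \<Rightarrow> 'a \<Rightarrow> 'a dual \<Rightarrow> real" where
  "gap x xs y ys = (1/2) * (norm (y - x))\<^sup>2 + (1/2) * (norm (ys - xs))\<^sup>2 + blinfun_apply (ys - xs) (y - x)"

definition near_solvable :: "('a::banach \<times> 'a dual) set \<Rightarrow> bool" where
  "near_solvable S \<longleftrightarrow> (\<forall>x xs. \<forall>e>0. \<exists>y ys. (y, ys) \<in> S \<and> gap x xs y ys \<le> e)"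

text \<open>Passing to the closure replaces the represented function by its lower semicontinuous
  hull. This matters for sets such as \<open>reg_sum_epi\<close>, which are projections and need not
  be closed.\<close>

definition contact_set :: "(('a::banach \<times> 'a dual) \<times> real) set \<Rightarrow> ('a \<times> 'a dual) set" where
  "contact_set E = {(x, xs). ((x, xs), blinfun_apply xs x) \<in> closure E}"

lemma gap_nonneg: "0 \<le> gap x xs y ys"
  unfolding gap_def using Fenchel_Young(2)[of "ys - xs" "y - x"] by linarith

lemma near_solvable_nonempty: "near_solvable S \<Longrightarrow> S \<noteq> {}"
  unfolding near_solvable_def by (metis empty_iff zero_less_one)

lemma dual_above_nonempty: "dual_above_pairing E \<Longrightarrow> E \<noteq> {}"
  unfolding dual_above_pairing_def by (metis empty_iff zero_less_one)

text \<open>Midpoint convexity: the pairing at the midpoint is at most the mean of \<open>s\<close>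
  and \<open>t\<close>, and it differs from the mean of the two pairings by a quarter of the pairing
  of the differences. With zero excesses this is monotonicity of the contact points.\<close>

lemma pairing_diff_lower_bound:
  assumes E: "convex E" "above_pairing E" and p: "((x, xs), s) \<in> E" "((y, ys), t) \<in> E"
  shows "- 2 * ((s - xs x) + (t - ys y)) \<le> blinfun_apply (xs - ys) (x - y)"
proof -
  have "(1/2) *\<^sub>R ((x, xs), s) + (1/2) *\<^sub>R ((y, ys), t) \<in> E"
    by (rule convexD[OF E(1) p]) auto
  then have "(((1/2) *\<^sub>R x + (1/2) *\<^sub>R y, (1/2) *\<^sub>R xs + (1/2) *\<^sub>R ys), (1/2) * s + (1/2) * t) \<in> E"
    by simp
  then have "((1/2) *\<^sub>R xs + (1/2) *\<^sub>R ys) ((1/2) *\<^sub>R x + (1/2) *\<^sub>R y) \<le> (1/2) * s + (1/2) * t"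
    using E(2) unfolding above_pairing_def by blast
  then show ?thesis by (simp add: blinfun.bilinear_simps algebra_simps)
qed

text \<open>The nonconvex term \<open>ys y\<close> inside \<open>gap\<close> cancels the subtracted
  one, so the objective is \<open>t\<close> plus a continuous convex quadratic. If it stayed above
  \<open>e\<close>, the sandwich functional would separate the two parts; the condition on the
  conjugate bounds the first, the conjugate of the square the second, and the Fenchel-Young
  inequality between dual and bidual contradicts \<open>e > 0\<close>.\<close>

lemma near_contact:
  fixes E :: "(('a::banach \<times> 'a dual) \<times> real) set"
  assumes E: "convex E" and dual: "dual_above_pairing E" and e: "e > 0"
  shows "\<exists>y ys t. ((y, ys), t) \<in> E \<and>
    t - ys y + gap x xs y ys \<le> e"
proof (rule ccontr)
  assume "\<not> ?thesis"
  then have neg: "e < t - ys y + gap x xs y ys" if "((y, ys), t) \<in> E" for y ys t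
    using that by (auto simp: not_le)
  define g where "g = (\<lambda>(y, ys). (1/2) * (norm (y - x))\<^sup>2 + (1/2) * (norm (ys - xs))\<^sup>2 - xs y - blinfun_apply ys x)"
  have g_eq: "g = (\<lambda>w. ((1/2) * (norm (fst w - x))\<^sup>2 + (1/2) * (norm (snd w - xs))\<^sup>2) + (- xs (fst w) - blinfun_apply (snd w) x))"
    by (auto simp: g_def)
  have aff: "a - (x::'c::real_vector) = u *\<^sub>R (b - x) + v *\<^sub>R (c - x)" 
    if "u + v = 1" "a = u *\<^sub>R b + v *\<^sub>R c" for a b c x u v
  proof -
    have "x = u *\<^sub>R x + v *\<^sub>R x" using that by (simp flip: scaleR_left_distrib)
    then show ?thesis using that by (simp add: algebra_simps)
  qed
  have "convex_on UNIV g"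
    unfolding g_eq
  proof (intro convex_on_add)
    show "convex_on UNIV (\<lambda>w :: 'a \<times> 'a dual. 1 / 2 * (norm (fst w - x))\<^sup>2)"
      by (rule convex_on_norm_sq_affine[where h = "\<lambda>w. fst w - x"]) (auto intro!: aff)
    show "convex_on UNIV (\<lambda>w :: 'a \<times> 'a dual. 1 / 2 * (norm (snd w - xs))\<^sup>2)"
      by (rule convex_on_norm_sq_affine[where h = "\<lambda>w. snd w - xs"]) (auto intro!: aff)
    show "convex_on UNIV (\<lambda>w :: 'a \<times> 'a dual. - xs (fst w) - blinfun_apply (snd w) x)"
      by (rule convex_onI) (auto simp: blinfun.bilinear_simps algebra_simps)
  qed
  moreover have "isCont g 0"
    unfolding g_eq by (intro continuous_intros)
  moreover have "e - xs x \<le> t + g w" if "(w, t) \<in> E" for w t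
    using neg[of "fst w" "snd w" t] that
    by (simp add: g_eq gap_def blinfun.bilinear_simps)
  ultimately obtain l where l: "\<And>w t w'. (w, t) \<in> E \<Longrightarrow> e - xs x \<le> t + blinfun_apply l w - l w' + g w'"
    using sandwich_functional[of E g "e - xs x"] E dual_above_nonempty[OF dual] by blast
  obtain l1 l2 where ls: "\<And>y ys. l (y, ys) = blinfun_apply l1 y + blinfun_apply l2 ys"
    using blinfun_prod_split by blast
  \<comment> \<open>Three approximate minimisations follow, each with error \<open>d\<close>, and
    \<open>3 * d < e\<close>.\<close>
  define d where "d = e / 4"
  have d: "d > 0" using e by (simp add: d_def)
  obtain y ys t where p: "((y, ys), t) \<in> E" "t + l2 ys + l1 y \<le> - l2 l1 + d"
    using dual[unfolded dual_above_pairing_def, rule_format, OF d, of "- l2" "- l1"]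
    by (auto simp: blinfun.bilinear_simps)
  \<comment> \<open>Centred at \<open>(x, xs)\<close>, \<open>g - l\<close> separates into two
    quadratics, in \<open>u\<close> and in \<open>us\<close>, with linear parts
    \<open>- (l1 + xs)\<close> and \<open>- (l2 + canon x)\<close>.\<close>
  obtain u where u: "1 / 2 * (norm u)\<^sup>2 + (- (l1 + xs)) u \<le> - (norm (- (l1 + xs)))\<^sup>2 / (2 * 1) + d"
    using quadratic_near_min[of 1 d "- (l1 + xs)"] d by auto
  obtain us where us: "1 / 2 * (norm us)\<^sup>2 + (- (l2 + canon x)) us \<le> - (norm (- (l2 + canon x)))\<^sup>2 / (2 * 1) + d"
    using quadratic_near_min[of 1 d "- (l2 + canon x)"] d by auto
  have fy: "- (l2 + canon x) (l1 + xs) \<le> 1/2 * (norm (l1 + xs))\<^sup>2 + 1/2 * (norm (l2 + canon x))\<^sup>2"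
    by (rule Fenchel_Young(2))
  have "e - xs x \<le> t + l (y, ys) - l (x + u, xs + us) + g (x + u, xs + us)"
    by (rule l[OF p(1)])
  also have "\<dots> = (t + l2 ys + l1 y) + (1/2 * (norm u)\<^sup>2 + (- (l1 + xs)) u) 
     + (1/2 * (norm us)\<^sup>2 + (- (l2 + canon x)) us) - l1 x - l2 xs - 2 * xs x"
    by (simp add: ls g_def blinfun.bilinear_simps algebra_simps)
  also have "\<dots> \<le> - l2 l1 + 3 * d - 1/2 * (norm (l1 + xs))\<^sup>2 - 1/2 * (norm (l2 + canon x))\<^sup>2 - l1 x - l2 xs - 2 * xs x"
    using p(2) u us unfolding norm_minus_cancel by simp
  also have "\<dots> \<le> 3 * d - xs x" using fy by (simp add: blinfun.bilinear_simps)
  finally show False using e by (simp add: d_def)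
qed

section \<open>From approximate to exact contact points\<close>

lemma convergent_of_geometric_steps:
  fixes f :: "nat \<Rightarrow> 'a::banach"
  assumes step: "\<And>k. norm (f (Suc k) - f k) \<le> c / 2 ^ k"
  obtains L where "f \<longlonglongrightarrow> L" and "norm (L - f 0) \<le> 2 * c"
proof -
  define d where "d k = f (Suc k) - f k" for k
  have geo: "(\<lambda>k. c / 2 ^ k) sums (c * 2)"
    using sums_mult[OF geometric_sums[of "1/2::real"], of c] by (simp add: power_divide)
  have sm: "summable (\<lambda>k. norm (d k))"
    by (rule summable_comparison_test'[OF sums_summable[OF geo]]) (simp add: d_def step)
  have part: "f 0 + (\<Sum>k<n. d k) = f n" for n
    by (simp add: d_def sum_lessThan_telescope)
  have "(\<lambda>n. f 0 + (\<Sum>k<n. d k)) \<longlonglongrightarrow> f 0 + suminf d"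
    using summable_LIMSEQ[OF summable_norm_cancel[OF sm]] by (intro tendsto_intros)
  then have "f \<longlonglongrightarrow> f 0 + suminf d" by (simp add: part)
  moreover have "norm (suminf d) \<le> c * 2"
  proof -
    have "norm (suminf d) \<le> (\<Sum>k. norm (d k))" by (rule summable_norm[OF sm])
    also have "\<dots> \<le> (\<Sum>k. c / 2 ^ k)"
      by (rule suminf_le[OF _ sm sums_summable[OF geo]]) (simp add: d_def step)
    finally show ?thesis using sums_unique[OF geo] by simp
  qed
  ultimately show ?thesis by (intro that[of "f 0 + suminf d"]) auto
qed

lemma contact_set_limit:
  assumes E: "\<And>n. ((y n, ys n), t n) \<in> closure E"
    and lim: "y \<longlonglongrightarrow> x" "ys \<longlonglongrightarrow> xs" "(\<lambda>n. t n - blinfun_apply (ys n) (y n)) \<longlonglongrightarrow> 0"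
  shows "(x, xs) \<in> contact_set E"
proof -
  have "(\<lambda>n. (t n - ys n (y n)) + ys n (y n)) \<longlonglongrightarrow> 0 + xs x"
    by (intro tendsto_intros lim)
  then have "(\<lambda>n. ((y n, ys n), t n)) \<longlonglongrightarrow> ((x, xs), xs x)"
    using lim by (intro tendsto_Pair) simp_all
  then have "((x, xs), xs x) \<in> closure E"
    by (rule closed_sequentially[OF closed_closure E])
  then show ?thesis by (simp add: contact_set_def)
qed

text \<open>Re-centring \<open>near_contact\<close> at the previous point gives steps of geometrically decreasing
  length, because convexity bounds the pairing of differences from below by the excesses.\<close>

lemma contact_near_small_excess:
  fixes E :: "(('a::banach \<times> 'a dual) \<times> real) set"
  assumes E: "convex E" "above_pairing E" "dual_above_pairing E"
    and p0: "((y0, ys0), t0) \<in> E" "t0 - ys0 y0 \<le> r\<^sup>2" and r: "r > 0"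
  obtains y ys where "(y, ys) \<in> contact_set E" "norm (y - y0) \<le> 6 * r" "norm (ys - ys0) \<le> 6 * r"
proof -
  define P where "P k p \<longleftrightarrow> p \<in> E \<and> (case p of ((y, ys), t) \<Rightarrow> t - blinfun_apply ys y \<le> (r / 2 ^ k)\<^sup>2)"
    for k :: nat and p
  define Q where "Q k p p' \<longleftrightarrow> norm (fst (fst p') - fst (fst p)) \<le> 3 * r / 2 ^ k \<and>
      norm (snd (fst p') - snd (fst p)) \<le> 3 * r / 2 ^ k" for k :: nat and p p' :: "('a \<times> 'a dual) \<times> real"
  have "\<exists>p'. P (Suc k) p' \<and> Q k p p'" if "P k p" for k p
  proof -
    obtain y ys t where p: "p = ((y, ys), t)" by (metis surj_pair)
    have t: "((y, ys), t) \<in> E" "t - ys y \<le> (r / 2 ^ k)\<^sup>2" using that by (auto simp: P_def p)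
    define d where "d = (r / 2 ^ k)\<^sup>2"
    have d: "d > 0" "(r / 2 ^ Suc k)\<^sup>2 = d / 4" using r by (auto simp: d_def power_divide field_simps)
    obtain y' ys' t' where n: "((y', ys'), t') \<in> E" "t' - ys' y' + gap y ys y' ys' \<le> d / 4"
      using near_contact[OF E(1,3), of "d / 4" y ys] d by auto
    have "- 2 * ((t' - ys' y') + (t - ys y)) \<le> (ys' - ys) (y' - y)"
      by (rule pairing_diff_lower_bound[OF E(1,2) n(1) t(1)])
    moreover have "ys' y' \<le> t'" using E(2) n(1) by (auto simp: above_pairing_def)
    moreover have "t' - ys' y' \<le> d / 4" using n(2) gap_nonneg[of y ys y' ys'] by linarith
    moreover have "t - ys y \<le> d" using t by (simp add: d_def)
    \<comment> \<open>The estimates yield \<open>5 * d\<close>. Rounding up to the square 9 gives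
      the step length \<open>3 * r / 2 ^ k\<close>, whose geometric sum is the \<open>6 * r\<close>
      of the conclusion.\<close>
    ultimately have sq: "(norm (y' - y))\<^sup>2 + (norm (ys' - ys))\<^sup>2 \<le> 9 * d"
      using n(2) d(1) unfolding gap_def by argo
    have 9: "9 * d = (3 * r / 2 ^ k)\<^sup>2" by (simp add: d_def power_divide power_mult_distrib)
    have "(norm (y' - y))\<^sup>2 \<le> (3 * r / 2 ^ k)\<^sup>2" "(norm (ys' - ys))\<^sup>2 \<le> (3 * r / 2 ^ k)\<^sup>2"
      using sq zero_le_power2[of "norm (y' - y)"] zero_le_power2[of "norm (ys' - ys)"]
      unfolding 9 by linarith+
    moreover have "0 \<le> 3 * r / 2 ^ k" using r by simp
    ultimately have le: "norm (y' - y) \<le> 3 * r / 2 ^ k" "norm (ys' - ys) \<le> 3 * r / 2 ^ k"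
      by (blast intro: power2_le_imp_le)+
    have "P (Suc k) ((y', ys'), t')" unfolding P_def using n(1) \<open>t' - ys' y' \<le> d / 4\<close> d(2) by simp
    then show ?thesis using le by (intro exI[of _ "((y', ys'), t')"]) (auto simp: Q_def p)
  qed
  note step = this
  \<comment> \<open>The clause for \<open>k = 0\<close> pins the start of the sequence inside
    dependent choice.\<close>
  have "\<exists>f. \<forall>k. ((k = 0 \<longrightarrow> f k = ((y0, ys0), t0)) \<and> P k (f k)) \<and> Q k (f k) (f (Suc k))"
  proof (rule dependent_nat_choice)
    show "\<exists>p. (0 = 0 \<longrightarrow> p = ((y0, ys0), t0)) \<and> P 0 p" using p0 by (auto simp: P_def)
    show "\<exists>p'. ((Suc k = 0 \<longrightarrow> p' = ((y0, ys0), t0)) \<and> P (Suc k) p') \<and> Q k p p'"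
      if "(k = 0 \<longrightarrow> p = ((y0, ys0), t0)) \<and> P k p" for p k
      using step[of k p] that by simp
  qed
  then obtain f where f: "f 0 = ((y0, ys0), t0)" "\<And>k. P k (f k)" "\<And>k. Q k (f k) (f (Suc k))" by blast
  define y where "y k = fst (fst (f k))" for k
  define ys where "ys k = snd (fst (f k))" for k
  define t where "t k = snd (f k)" for k
  have fe: "f k = ((y k, ys k), t k)" for k by (simp add: y_def ys_def t_def)
  have steps: "norm (y (Suc k) - y k) \<le> 3 * r / 2 ^ k" "norm (ys (Suc k) - ys k) \<le> 3 * r / 2 ^ k" for k
    using f(3)[of k] by (auto simp: Q_def y_def ys_def)
  obtain L where L: "y \<longlonglongrightarrow> L" "norm (L - y 0) \<le> 2 * (3 * r)"
    using convergent_of_geometric_steps[OF steps(1)] .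
  obtain Ls where Ls: "ys \<longlonglongrightarrow> Ls" "norm (Ls - ys 0) \<le> 2 * (3 * r)"
    using convergent_of_geometric_steps[OF steps(2)] .
  have inE: "((y k, ys k), t k) \<in> E" and small: "t k - ys k (y k) \<le> (r / 2 ^ k)\<^sup>2" for k
    using f(2)[of k] by (auto simp: P_def fe)
  have "(\<lambda>k. t k - ys k (y k)) \<longlonglongrightarrow> 0"
  proof (rule tendsto_sandwich)
    show "\<forall>\<^sub>F k in sequentially. 0 \<le> t k - ys k (y k)"
      using inE E(2) by (auto simp: above_pairing_def)
    show "\<forall>\<^sub>F k in sequentially. t k - ys k (y k) \<le> (r / 2 ^ k)\<^sup>2" using small by simp
    have "(\<lambda>k. (r * (1 / 2) ^ k)\<^sup>2) \<longlonglongrightarrow> (r * 0)\<^sup>2"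
      by (intro tendsto_intros LIMSEQ_realpow_zero) auto
    then show "(\<lambda>k. (r / 2 ^ k)\<^sup>2) \<longlonglongrightarrow> 0" by (simp add: power_divide)
  qed simp
  then have "(L, Ls) \<in> contact_set E"
    using contact_set_limit[of y ys t E L Ls] inE closure_subset L(1) Ls(1) by blast
  moreover have "y 0 = y0" "ys 0 = ys0" using f(1) by (simp_all add: y_def ys_def)
  ultimately show ?thesis using L(2) Ls(2) by (intro that[of L Ls]) auto
qed

text \<open>A fixed reference point of \<open>E\<close> bounds the pairing in \<open>gap\<close>
  from below by an affine function of the two distances, which the squares dominate. The radius is
  thus known before the tolerance is chosen.\<close>

lemma near_contact_bounded:
  fixes E :: "(('a::banach \<times> 'a dual) \<times> real) set"
  assumes E: "convex E" "above_pairing E" "E \<noteq> {}"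
  obtains R where "R \<ge> 0" "\<And>y ys t. ((y, ys), t) \<in> E \<Longrightarrow> t - ys y + gap x xs y ys \<le> 1 \<Longrightarrow>
    norm (y - x) \<le> R \<and> norm (ys - xs) \<le> R"
proof -
  obtain y1 ys1 t1 where e: "((y1, ys1), t1) \<in> E" using E(3) by auto
  define r where "r = norm (y1 - x) + norm (ys1 - xs)"
  \<comment> \<open>The 3 is the bound 1 on the objective plus twice the bound 1 on the excess of
    the point; the reference point contributes twice its excess and \<open>r * r\<close>. Completing
    the squares in \<open>a\<close> and \<open>b\<close> then adds \<open>r\<^sup>2\<close> for
    each.\<close>
  define K where "K = 3 + 2 * (t1 - ys1 y1) + r * r"
  have r0: "r \<ge> 0" by (simp add: r_def)
  have K0: "K \<ge> 0" using E(2) e r0 by (auto simp: K_def above_pairing_def)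
  have "norm (y - x) \<le> r + sqrt (2 * K + 2 * r\<^sup>2) \<and> norm (ys - xs) \<le> r + sqrt (2 * K + 2 * r\<^sup>2)"
    if p: "((y, ys), t) \<in> E" "t - ys y + gap x xs y ys \<le> 1" for y ys t
  proof -
    define a b where "a = norm (y - x)" and "b = norm (ys - xs)"
    have ab: "a \<ge> 0" "b \<ge> 0" by (auto simp: a_def b_def)
    have s: "0 \<le> t - ys y" "t - ys y \<le> 1"
      using E(2) p gap_nonneg[of x xs y ys] by (auto simp: above_pairing_def)
    have "- 2 * ((t - ys y) + (t1 - ys1 y1)) \<le> (ys - ys1) (y - y1)"
      by (rule pairing_diff_lower_bound[OF E(1,2) p(1) e])
    also have "(ys - ys1) (y - y1) = (ys - xs) (y - x) - (ys - xs) (y1 - x) - (ys1 - xs) (y - x)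
        + (ys1 - xs) (y1 - x)"
      by (simp add: blinfun.bilinear_simps algebra_simps)
    also have "\<dots> \<le> (ys - xs) (y - x) + b * r + r * a + r * r"
    proof -
      have 1: "\<bar>(ys - xs) (y1 - x)\<bar> \<le> b * norm (y1 - x)"
        using norm_blinfun[of "ys - xs" "y1 - x"] by (simp add: b_def)
      have 2: "\<bar>(ys1 - xs) (y - x)\<bar> \<le> norm (ys1 - xs) * a"
        using norm_blinfun[of "ys1 - xs" "y - x"] by (simp add: a_def)
      have 3: "\<bar>(ys1 - xs) (y1 - x)\<bar> \<le> norm (ys1 - xs) * norm (y1 - x)"
        using norm_blinfun[of "ys1 - xs" "y1 - x"] by simp
      have "b * norm (y1 - x) \<le> b * r" "norm (ys1 - xs) * a \<le> r * a"
        "norm (ys1 - xs) * norm (y1 - x) \<le> r * r"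
        using ab by (auto simp: r_def intro!: mult_left_mono mult_right_mono mult_mono)
      then show ?thesis using 1 2 3 by linarith
    qed
    finally have low: "- 2 - 2 * (t1 - ys1 y1) \<le> (ys - xs) (y - x) + b * r + r * a + r * r"
      using s by argo
    have "(1/2) * a\<^sup>2 + (1/2) * b\<^sup>2 + (ys - xs) (y - x) \<le> 1"
      using p(2) s unfolding gap_def a_def b_def by linarith
    then have "(1/2) * a\<^sup>2 + (1/2) * b\<^sup>2 \<le> K + b * r + r * a"
      using low by (simp add: K_def)
    then have q: "(a - r)\<^sup>2 + (b - r)\<^sup>2 \<le> 2 * K + 2 * r\<^sup>2"
      by (simp add: power2_eq_square algebra_simps)
    have "(a - r)\<^sup>2 \<le> 2 * K + 2 * r\<^sup>2" "(b - r)\<^sup>2 \<le> 2 * K + 2 * r\<^sup>2"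
      using q zero_le_power2[of "a - r"] zero_le_power2[of "b - r"] by linarith+
    then have "a - r \<le> sqrt (2 * K + 2 * r\<^sup>2)" "b - r \<le> sqrt (2 * K + 2 * r\<^sup>2)"
      by (auto intro!: real_le_rsqrt)
    then show ?thesis by (simp add: a_def b_def)
  qed
  then show ?thesis using r0 K0 by (intro that[of "r + sqrt (2 * K + 2 * r\<^sup>2)"]) auto
qed

lemma gap_perturb:
  assumes "norm (y0 - x) \<le> R" "norm (ys0 - xs) \<le> R" "norm (y - y0) \<le> d" "norm (ys - ys0) \<le> d"
  shows "gap x xs y ys \<le> gap x xs y0 ys0 + 4 * R * d + 2 * d\<^sup>2"
proof -
  have R: "R \<ge> 0" and d: "d \<ge> 0" using assms(1,3) norm_ge_zero order_trans by blast+
  have sq: "(norm (u - v))\<^sup>2 \<le> (norm (w - v))\<^sup>2 + 2 * R * d + d\<^sup>2"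
    if "norm (w - v) \<le> R" "norm (u - w) \<le> d" for u v w :: "'c::real_normed_vector"
  proof -
    have "norm (u - v) \<le> norm (w - v) + norm (u - w)"
      using norm_triangle_ineq[of "w - v" "u - w"] by simp
    then have "(norm (u - v))\<^sup>2 \<le> (norm (w - v) + norm (u - w))\<^sup>2" by (intro power_mono) auto
    also have "\<dots> = (norm (w - v))\<^sup>2 + 2 * (norm (w - v) * norm (u - w)) + (norm (u - w))\<^sup>2"
      by (simp add: power2_eq_square algebra_simps)
    also have "\<dots> \<le> (norm (w - v))\<^sup>2 + 2 * (R * d) + d\<^sup>2"
      using that R d by (intro add_mono mult_mono power_mono mult_left_mono order_refl) auto
    finally show ?thesis by simp
  qed
  have "(ys - xs) (y - x) = (ys0 - xs) (y0 - x) + (ys0 - xs) (y - y0) + (ys - ys0) (y0 - x) + (ys - ys0) (y - y0)"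
    by (simp add: blinfun.bilinear_simps algebra_simps)
  also have "\<dots> \<le> (ys0 - xs) (y0 - x) + R * d + d * R + d * d"
  proof -
    have b: "f v \<le> A * B" if "norm f \<le> A" "norm v \<le> B" "A \<ge> 0" for f :: "'a dual" and v A B
    proof -
      have "f v \<le> norm f * norm v" using norm_blinfun[of f v] by simp
      also have "\<dots> \<le> A * B" using that by (intro mult_mono) auto
      finally show ?thesis .
    qed
    show ?thesis using assms R d by (intro add_mono b order_refl)
  qed
  finally show ?thesis
    using sq[OF assms(1,3)] sq[OF assms(2,4)]
    unfolding gap_def by (simp add: power2_eq_square algebra_simps)
qed

theorem near_solvable_contact_set:
  fixes E :: "(('a::banach \<times> 'a dual) \<times> real) set"
  assumes E: "convex E" "above_pairing E" "dual_above_pairing E"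
  shows "near_solvable (contact_set E)"
  unfolding near_solvable_def
proof (intro allI impI)
  fix x :: 'a and xs :: "'a dual" and e :: real assume e: "e > 0"
  obtain R where R: "R \<ge> 0" "\<And>y ys t. ((y, ys), t) \<in> E \<Longrightarrow> t - ys y + gap x xs y ys \<le> 1 \<Longrightarrow>
      norm (y - x) \<le> R \<and> norm (ys - xs) \<le> R"
    using near_contact_bounded[OF E(1,2) dual_above_nonempty[OF E(3)]] by blast
  \<comment> \<open>Moving by \<open>6 * r\<close> raises the gap by at most
    \<open>24 * R * r + 72 * r\<^sup>2\<close>. With the initial \<open>r\<^sup>2\<close> and
    \<open>r \<le> 1\<close> the total is at most \<open>(73 + 24 * R) * r\<close>.\<close>
  define r where "r = min 1 (e / (73 + 24 * R))"
  have r: "r > 0" "r \<le> 1" using e R by (auto simp: r_def)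
  have "r * (73 + 24 * R) \<le> e"
    using R(1) by (simp add: pos_le_divide_eq[symmetric] r_def)
  moreover have "r\<^sup>2 \<le> r" using r by (simp add: power2_eq_square mult_left_le)
  ultimately have re: "r\<^sup>2 + 4 * R * (6 * r) + 2 * (6 * r)\<^sup>2 \<le> e"
    by (simp add: power_mult_distrib algebra_simps)
  obtain y0 ys0 t0 where p0: "((y0, ys0), t0) \<in> E" "t0 - ys0 y0 + gap x xs y0 ys0 \<le> r\<^sup>2"
    using near_contact[OF E(1,3), of "r\<^sup>2" x xs] r by auto
  have "0 \<le> t0 - ys0 y0" using p0(1) E(2) by (auto simp: above_pairing_def)
  then have s: "t0 - ys0 y0 \<le> r\<^sup>2" "gap x xs y0 ys0 \<le> r\<^sup>2"
    using p0(2) gap_nonneg[of x xs y0 ys0] by linarith+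
  have "norm (y0 - x) \<le> R" "norm (ys0 - xs) \<le> R"
    using R(2)[OF p0(1)] p0(2) r \<open>r\<^sup>2 \<le> r\<close> by linarith+
  note b = this
  obtain y ys where y: "(y, ys) \<in> contact_set E" "norm (y - y0) \<le> 6 * r" "norm (ys - ys0) \<le> 6 * r"
    using contact_near_small_excess[OF E p0(1) s(1) r(1)] .
  have "gap x xs y ys \<le> e"
    using gap_perturb[OF b y(2,3)] s(2) re by linarith
  then show "\<exists>y ys. (y, ys) \<in> contact_set E \<and> gap x xs y ys \<le> e" using y(1) by blast
qed

text \<open>The pairing is the only term of \<open>gap\<close> that can be negative, so a lower
  bound on it controls both norms by \<open>sqrt (2 * (e n + d n))\<close>.\<close>

lemma gap_tendsto:
  assumes gap: "\<And>n. gap (x n) (xs n) (y n) (ys n) \<le> e n" and e: "e \<longlonglongrightarrow> 0"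
    and low: "\<And>n. - d n \<le> blinfun_apply (ys n - xs n) (y n - x n)" and d: "d \<longlonglongrightarrow> 0"
  shows "(\<lambda>n. y n - x n) \<longlonglongrightarrow> 0" and "(\<lambda>n. ys n - xs n) \<longlonglongrightarrow> 0"
proof -
  have sq: "(norm (y n - x n))\<^sup>2 + (norm (ys n - xs n))\<^sup>2 \<le> 2 * (e n + d n)" for n
    using gap[of n] low[of n] unfolding gap_def by argo
  have le: "norm (y n - x n) \<le> sqrt (2 * (e n + d n))" "norm (ys n - xs n) \<le> sqrt (2 * (e n + d n))" for n
    using sq[of n] zero_le_power2[of "norm (y n - x n)"] zero_le_power2[of "norm (ys n - xs n)"]
    by (intro real_le_rsqrt; linarith)+
  have "(\<lambda>n. sqrt (2 * (e n + d n))) \<longlonglongrightarrow> sqrt (2 * (0 + 0))"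
    by (intro tendsto_intros e d)
  then have lim: "(\<lambda>n. sqrt (2 * (e n + d n))) \<longlonglongrightarrow> 0" by simp
  show "(\<lambda>n. y n - x n) \<longlonglongrightarrow> 0"
    by (rule Lim_null_comparison[OF _ lim]) (simp only: le eventually_True)
  show "(\<lambda>n. ys n - xs n) \<longlonglongrightarrow> 0"
    by (rule Lim_null_comparison[OF _ lim]) (simp only: le eventually_True)
qed

lemma near_solvable_related_limit:
  assumes S: "near_solvable S"
    and rel: "\<And>y ys. (y, ys) \<in> S \<Longrightarrow> 0 \<le> blinfun_apply (ys - xs) (y - x)"
  obtains y ys where "\<And>n::nat. (y n, ys n) \<in> S" "y \<longlonglongrightarrow> x" "ys \<longlonglongrightarrow> xs"
proof -
  have "\<exists>y ys. (y, ys) \<in> S \<and> gap x xs y ys \<le> inverse (real (Suc n))" for n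
    using S unfolding near_solvable_def by simp
  then obtain y ys where y: "\<And>n. (y n, ys n) \<in> S" "\<And>n. gap x xs (y n) (ys n) \<le> inverse (real (Suc n))"
    by metis
  have "(\<lambda>n. y n - x) \<longlonglongrightarrow> 0" "(\<lambda>n. ys n - xs) \<longlonglongrightarrow> 0"
    using gap_tendsto[of "\<lambda>_. x" "\<lambda>_. xs" y ys "\<lambda>n. inverse (real (Suc n))" "\<lambda>_. 0"]
      y(2) LIMSEQ_inverse_real_of_nat rel[OF y(1)] by auto
  then have "y \<longlonglongrightarrow> x" "ys \<longlonglongrightarrow> xs" by (simp_all add: LIM_zero_iff)
  with y(1) show ?thesis by (rule that)
qed

text \<open>Near solvability centred at a monotonically related point makes both squares in
  \<open>gap\<close> small; the point is a limit of contact points, and these form a closed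
  set.\<close>

lemma contact_set_maximal:
  assumes "near_solvable (contact_set E)"
    and "\<And>y ys. (y, ys) \<in> contact_set E \<Longrightarrow> 0 \<le> blinfun_apply (ys - xs) (y - x)"
  shows "(x, xs) \<in> contact_set E"
proof -
  obtain y ys where y: "\<And>n::nat. (y n, ys n) \<in> contact_set E" "y \<longlonglongrightarrow> x" "ys \<longlonglongrightarrow> xs"
    using near_solvable_related_limit[OF assms] by blast
  have "((y n, ys n), ys n (y n)) \<in> closure E" for n
    using y(1)[of n] by (simp add: contact_set_def)
  then show ?thesis
    using contact_set_limit[of y ys "\<lambda>n. ys n (y n)" E x xs] y(2,3) by simp
qed

subsection \<open>The duality map\<close>

text \<open>The epigraph of \<open>f x + f* xs\<close>, where \<open>f\<close> is half the squared
  norm and \<open>f*\<close> its conjugate. Equality in Fenchel-Young makes its contact set the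
  graph of the duality map.\<close>

definition half_sq_epi :: "(('a::banach \<times> 'a dual) \<times> real) set" where
  "half_sq_epi = {((x, xs), t). (1/2) * (norm x)\<^sup>2 + (1/2) * (norm xs)\<^sup>2 \<le> t}"

lemma convex_half_sq_epi: "convex (half_sq_epi :: (('a::banach \<times> 'a dual) \<times> real) set)"
proof (rule convexI)
  fix p q :: "('a \<times> 'a dual) \<times> real" and u v :: real
  assume pq: "p \<in> half_sq_epi" "q \<in> half_sq_epi" and uv: "0 \<le> u" "0 \<le> v" "u + v = 1"
  obtain x xs s where p: "p = ((x, xs), s)" by (metis surj_pair)
  obtain y ys t where q: "q = ((y, ys), t)" by (metis surj_pair)
  have le: "(1/2) * (norm x)\<^sup>2 + (1/2) * (norm xs)\<^sup>2 \<le> s" "(1/2) * (norm y)\<^sup>2 + (1/2) * (norm ys)\<^sup>2 \<le> t"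
    using pq unfolding p q half_sq_epi_def by simp_all
  have "(1/2) * (norm (u *\<^sub>R x + v *\<^sub>R y))\<^sup>2 + (1/2) * (norm (u *\<^sub>R xs + v *\<^sub>R ys))\<^sup>2
      \<le> u * ((1/2) * (norm x)\<^sup>2 + (1/2) * (norm xs)\<^sup>2) + v * ((1/2) * (norm y)\<^sup>2 + (1/2) * (norm ys)\<^sup>2)"
    using norm_sq_convex[OF uv, of x y] norm_sq_convex[OF uv, of xs ys] by argo
  also have "\<dots> \<le> u * s + v * t"
    by (intro add_mono mult_left_mono le uv)
  finally show "u *\<^sub>R p + v *\<^sub>R q \<in> half_sq_epi"
    by (simp add: half_sq_epi_def p q)
qed

lemma closed_half_sq_epi: "closed (half_sq_epi :: (('a::banach \<times> 'a dual) \<times> real) set)"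
proof -
  have "half_sq_epi = {p :: ('a \<times> 'a dual) \<times> real.
      (1/2) * (norm (fst (fst p)))\<^sup>2 + (1/2) * (norm (snd (fst p)))\<^sup>2 \<le> snd p}"
    by (auto simp: half_sq_epi_def)
  also have "closed \<dots>" by (intro closed_Collect_le continuous_intros)
  finally show ?thesis .
qed

lemma near_solvable_half_sq:
  "near_solvable {(y :: 'a::banach, ys :: 'a dual). (1/2) * (norm y)\<^sup>2 + (1/2) * (norm ys)\<^sup>2 \<le> blinfun_apply ys y}"
proof -
  let ?E = "half_sq_epi :: (('a \<times> 'a dual) \<times> real) set"
  have "above_pairing ?E"
    unfolding above_pairing_def
  proof (intro allI impI)
    fix x :: 'a and xs :: "'a dual" and t assume "((x, xs), t) \<in> ?E"
    then have "(1/2) * (norm x)\<^sup>2 + (1/2) * (norm xs)\<^sup>2 \<le> t" by (simp add: half_sq_epi_def)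
    then show "xs x \<le> t" using Fenchel_Young(1)[of xs x] by linarith
  qed
  moreover have "dual_above_pairing ?E"
    unfolding dual_above_pairing_def
  proof (intro allI impI)
    fix z :: "'a bidual" and xs :: "'a dual" and e :: real assume e: "e > 0"
    obtain y where y: "1 / 2 * (norm y)\<^sup>2 + (- xs) y \<le> - (norm (- xs))\<^sup>2 / (2 * 1) + e / 2"
      using quadratic_near_min[of 1 "e / 2" "- xs"] e by auto
    obtain ys where ys: "1 / 2 * (norm ys)\<^sup>2 + (- z) ys \<le> - (norm (- z))\<^sup>2 / (2 * 1) + e / 2"
      using quadratic_near_min[of 1 "e / 2" "- z"] e by auto
    have "((1/2) * (norm y)\<^sup>2 + (1/2) * (norm ys)\<^sup>2) - z ys - xs y \<le> - z xs + e"
      using y ys Fenchel_Young(1)[of z xs] by (simp add: blinfun.bilinear_simps)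
    moreover have "((y, ys), (1/2) * (norm y)\<^sup>2 + (1/2) * (norm ys)\<^sup>2) \<in> ?E" by (simp add: half_sq_epi_def)
    ultimately show "\<exists>y ys t. ((y, ys), t) \<in> ?E \<and> t - blinfun_apply z ys - blinfun_apply xs y \<le> - blinfun_apply z xs + e"
      by blast
  qed
  ultimately have "near_solvable (contact_set ?E)"
    by (intro near_solvable_contact_set convex_half_sq_epi)
  then show ?thesis
    unfolding contact_set_def closure_closed[OF closed_half_sq_epi] by (simp add: half_sq_epi_def)
qed

text \<open>Choose \<open>y0\<close> with Fenchel-Young excess at most \<open>e\<close> against
  \<open>u\<close> and centre near solvability at \<open>(y0, u)\<close>. The excess bounds the
  pairing of differences below by \<open>- e\<close>, hence
  \<open>(norm (ys - u))\<^sup>2 \<le> 4 * e = r\<^sup>2\<close>.\<close>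

lemma Bishop_Phelps:
  fixes u :: "'a::banach dual"
  assumes r: "r > 0"
  obtains y :: 'a and ys :: "'a dual"
  where "(1/2) * (norm y)\<^sup>2 + (1/2) * (norm ys)\<^sup>2 \<le> blinfun_apply ys y" "norm (ys - u) \<le> r"
proof -
  define e where "e = r\<^sup>2 / 4"
  have e: "e > 0" using r by (simp add: e_def)
  obtain y0 where y0: "1 / 2 * (norm y0)\<^sup>2 + (- u) y0 \<le> - (norm (- u))\<^sup>2 / (2 * 1) + e"
    using quadratic_near_min[of 1 e "- u"] e by auto
  obtain y ys where y: "(1/2) * (norm y)\<^sup>2 + (1/2) * (norm ys)\<^sup>2 \<le> blinfun_apply ys y" "gap y0 u y ys \<le> e"
    using near_solvable_half_sq e unfolding near_solvable_def by blast
  have "- e \<le> (ys - u) (y - y0)"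
    using y0 y(1) Fenchel_Young(1)[of ys y0] Fenchel_Young(1)[of u y]
    by (simp add: blinfun.bilinear_simps)
  then have "(norm (ys - u))\<^sup>2 \<le> r\<^sup>2"
    using y(2) zero_le_power2[of "norm (y - y0)"] unfolding gap_def e_def by argo
  then have "norm (ys - u) \<le> r" using r power2_le_imp_le[of "norm (ys - u)" r] by simp
  with y(1) show ?thesis by (rule that)
qed

lemma duality_mapI:
  assumes "(1/2) * (norm y)\<^sup>2 + (1/2) * (norm ys)\<^sup>2 \<le> blinfun_apply ys y"
  shows "(y, ys) \<in> duality_map"
proof -
  have "(1/2) * (norm y)\<^sup>2 + ys (v - y) \<le> (1/2) * (norm v)\<^sup>2" for v
    using assms Fenchel_Young(1)[of ys v] by (simp add: blinfun.bilinear_simps)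
  then show ?thesis by (simp add: duality_map_def subdiff_def)
qed

lemma norm_eq_of_duality:
  assumes "(1/2) * (norm y)\<^sup>2 + (1/2) * (norm ys)\<^sup>2 \<le> blinfun_apply ys y"
  shows "norm y = norm ys"
proof -
  have "ys y \<le> norm ys * norm y" using norm_blinfun[of ys y] by simp
  then have "(norm y - norm ys)\<^sup>2 \<le> 0" using assms unfolding power2_diff by argo
  then show ?thesis by simp
qed

text \<open>An element of \<open>tilde duality_map\<close> is a subgradient of half the squared dual norm: compare it with
  points of the duality map whose functionals approach the segment from \<open>xs\<close> to \<open>xs + d\<close>.\<close>

lemma tilde_duality_map_subgradient:
  assumes "(z, xs) \<in> tilde duality_map"
  shows "blinfun_apply z d \<le> (1/2) * (norm (xs + d))\<^sup>2 - (1/2) * (norm xs)\<^sup>2"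
proof -
  have main: "(1 - t) * z d \<le> (1/2) * (norm (xs + d))\<^sup>2 - (1/2) * (norm (xs + t *\<^sub>R d))\<^sup>2"
    if t: "0 < t" "t < 1" for t :: real
  proof -
    define u where "u = xs + t *\<^sub>R d"
    have "\<exists>y ys. (1/2) * (norm y)\<^sup>2 + (1/2) * (norm ys)\<^sup>2 \<le> blinfun_apply ys y \<and>
        norm (ys - u) \<le> inverse (real (Suc n))" for n
      by (rule Bishop_Phelps[of "inverse (real (Suc n))" u]) auto
    then obtain y ys where y: "\<And>n. (1/2) * (norm (y n))\<^sup>2 + (1/2) * (norm (ys n))\<^sup>2 \<le> blinfun_apply (ys n) (y n)"
      and ys: "\<And>n. norm (ys n - u) \<le> inverse (real (Suc n))" by metis
    have lim0: "(\<lambda>n. ys n - u) \<longlonglongrightarrow> 0"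
      by (rule Lim_null_comparison[OF _ LIMSEQ_inverse_real_of_nat]) (simp only: ys eventually_True)
    then have lim: "ys \<longlonglongrightarrow> u" by (simp only: LIM_zero_iff)
    have "(\<lambda>n. norm (ys n - u) * norm (ys n)) \<longlonglongrightarrow> norm (0 :: 'a dual) * norm u"
      by (intro tendsto_intros lim0 lim)
    then have prod: "(\<lambda>n. norm (ys n - u) * norm (ys n)) \<longlonglongrightarrow> 0" by simp
    have le: "norm ((ys n - u) (y n)) \<le> norm (ys n - u) * norm (ys n)" for n
      using norm_blinfun[of "ys n - u" "y n"] norm_eq_of_duality[OF y] by simp
    have err: "(\<lambda>n. (ys n - u) (y n)) \<longlonglongrightarrow> 0"
      by (rule Lim_null_comparison[OF _ prod]) (simp only: le eventually_True)
    \<comment> \<open>The monotone relation is weighted by \<open>1 - t\<close> and the subgradient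
      inequality towards \<open>xs + d\<close> by \<open>t\<close>. With these weights the values at
      the unknown \<open>y n\<close> combine to \<open>(ys n - u) (y n)\<close>, which vanishes in
      the limit because \<open>norm (y n) = norm (ys n)\<close> stays bounded.\<close>
    have ineq: "t * ((1/2) * (norm (ys n))\<^sup>2) + (1 - t) * z (ys n - xs) - (ys n - u) (y n)
        \<le> t * ((1/2) * (norm (xs + d))\<^sup>2)" for n
    proof -
      have 1: "z (ys n - xs) \<le> (ys n - xs) (y n)"
        using assms duality_mapI[OF y[of n]] by (auto simp: tilde_def blinfun.bilinear_simps)
      have 2: "(1/2) * (norm (ys n))\<^sup>2 + (xs + d - ys n) (y n) \<le> (1/2) * (norm (xs + d))\<^sup>2"
        using Fenchel_Young(1)[of "xs + d" "y n"] y[of n] by (simp add: blinfun.bilinear_simps)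
      have "(1 - t) * z (ys n - xs) \<le> (1 - t) * (ys n - xs) (y n)"
        using 1 t by (intro mult_left_mono) auto
      moreover have "t * ((1/2) * (norm (ys n))\<^sup>2 + (xs + d - ys n) (y n)) \<le> t * ((1/2) * (norm (xs + d))\<^sup>2)"
        using 2 t by (intro mult_left_mono) auto
      moreover have "t * (xs + d - ys n) (y n) + (1 - t) * (ys n - xs) (y n)
          = (1 - 2 * t) * (ys n - xs) (y n) + t * d (y n)"
        by (simp add: blinfun.bilinear_simps algebra_simps)
      ultimately show ?thesis
        by (simp add: u_def blinfun.bilinear_simps algebra_simps)
    qed
    have "(\<lambda>n. t * ((1/2) * (norm (ys n))\<^sup>2) + (1 - t) * z (ys n - xs) - (ys n - u) (y n))
        \<longlonglongrightarrow> t * ((1/2) * (norm u)\<^sup>2) + (1 - t) * z (u - xs) - 0"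
      by (intro tendsto_intros lim err)
    then have "t * ((1/2) * (norm u)\<^sup>2) + (1 - t) * z (u - xs) - 0 \<le> t * ((1/2) * (norm (xs + d))\<^sup>2)"
      using ineq by (intro LIMSEQ_le_const2) auto
    then have "t * ((1/2) * (norm u)\<^sup>2 + (1 - t) * z d) \<le> t * ((1/2) * (norm (xs + d))\<^sup>2)"
      by (simp add: u_def blinfun.bilinear_simps algebra_simps)
    then show ?thesis using t by (simp add: u_def)
  qed
  \<comment> \<open>The double successor keeps \<open>\<tau> n\<close> below 1 already at
    \<open>n = 0\<close>.\<close>
  define \<tau> where "\<tau> n = inverse (real (Suc (Suc n)))" for n
  have \<tau>: "0 < \<tau> n" "\<tau> n < 1" for n by (auto simp: \<tau>_def field_simps)
  have "\<tau> \<longlonglongrightarrow> 0" unfolding \<tau>_def using LIMSEQ_Suc[OF LIMSEQ_inverse_real_of_nat] .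
  then have "(\<lambda>n. (1/2) * (norm (xs + d))\<^sup>2 - (1/2) * (norm (xs + \<tau> n *\<^sub>R d))\<^sup>2 - (1 - \<tau> n) * z d)
      \<longlonglongrightarrow> (1/2) * (norm (xs + d))\<^sup>2 - (1/2) * (norm (xs + 0 *\<^sub>R d))\<^sup>2 - (1 - 0) * z d"
    by (intro tendsto_intros)
  then have "0 \<le> (1/2) * (norm (xs + d))\<^sup>2 - (1/2) * (norm (xs + 0 *\<^sub>R d))\<^sup>2 - (1 - 0) * z d"
    using main[OF \<tau>] by (intro LIMSEQ_le_const) auto
  then show ?thesis by simp
qed

text \<open>The subgradient inequality says that \<open>xs\<close> maximises
  \<open>z w - (norm w)\<^sup>2 / 2\<close> over \<open>w\<close>. A near-maximiser shows that this
  maximum is at least \<open>(norm z)\<^sup>2 / 2\<close>.\<close>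

lemma tilde_duality_map_norms:
  assumes "(z, xs) \<in> tilde duality_map"
  shows "(1/2) * (norm z)\<^sup>2 + (1/2) * (norm xs)\<^sup>2 \<le> blinfun_apply z xs"
proof (rule field_le_epsilon)
  fix e :: real assume e: "e > 0"
  obtain w where w: "1 / 2 * (norm w)\<^sup>2 + (- z) w \<le> - (norm (- z))\<^sup>2 / (2 * 1) + e"
    using quadratic_near_min[of 1 e "- z"] e by auto
  show "(1/2) * (norm z)\<^sup>2 + (1/2) * (norm xs)\<^sup>2 \<le> z xs + e"
    using w tilde_duality_map_subgradient[OF assms, of "w - xs"] by (simp add: blinfun.bilinear_simps)
qed

subsection \<open>Regularised sums\<close>

text \<open>With \<open>c = 1 / \<lambda>\<close> and \<open>E1\<close>, \<open>E2\<close> representing \<open>T\<close> and \<open>B\<close>, this set represents \<open>T\<^sub>\<lambda> + B\<close>.\<close>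

definition reg_sum_epi :: "real \<Rightarrow> (('a::banach \<times> 'a dual) \<times> real) set \<Rightarrow>
    (('a \<times> 'a dual) \<times> real) set \<Rightarrow> (('a \<times> 'a dual) \<times> real) set" where
  "reg_sum_epi c E1 E2 = {((y, ys), r). \<exists>z a b s t. ((z, a), s) \<in> E1 \<and> ((y, b), t) \<in> E2 \<and>
     ys = a + b \<and> s + t + c / 2 * (norm (y - z))\<^sup>2 + (norm a)\<^sup>2 / (2 * c) \<le> r}"

lemma reg_sum_epiE:
  assumes "((y, ys), r) \<in> reg_sum_epi c E1 E2"
  obtains z a b s t where "((z, a), s) \<in> E1" "((y, b), t) \<in> E2" "ys = a + b"
    "s + t + c / 2 * (norm (y - z))\<^sup>2 + (norm a)\<^sup>2 / (2 * c) \<le> r"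
  using assms unfolding reg_sum_epi_def by blast

lemma reg_sum_epiI:
  assumes "((z, a), s) \<in> E1" "((y, b), t) \<in> E2"
    "s + t + c / 2 * (norm (y - z))\<^sup>2 + (norm a)\<^sup>2 / (2 * c) \<le> r"
  shows "((y, a + b), r) \<in> reg_sum_epi c E1 E2"
  using assms unfolding reg_sum_epi_def by blast

lemma convexD_pairs:
  assumes "convex E" "((x, xs), s) \<in> E" "((y, ys), t) \<in> E" "u \<ge> 0" "v \<ge> 0" "u + v = 1"
  shows "((u *\<^sub>R x + v *\<^sub>R y, u *\<^sub>R xs + v *\<^sub>R ys), u * s + v * t) \<in> E"
  using convexD[OF assms] by simp

lemma convex_reg_sum_epi:
  assumes c: "c > 0" and E: "convex E1" "convex E2"
  shows "convex (reg_sum_epi c E1 E2)"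
proof (rule convexI)
  fix p p' :: "('a \<times> 'a dual) \<times> real" and u v :: real
  assume p: "p \<in> reg_sum_epi c E1 E2" "p' \<in> reg_sum_epi c E1 E2" and uv: "0 \<le> u" "0 \<le> v" "u + v = 1"
  obtain y ys r where pe: "p = ((y, ys), r)" by (metis surj_pair)
  obtain y' ys' r' where pe': "p' = ((y', ys'), r')" by (metis surj_pair)
  obtain z a b s t where q: "((z, a), s) \<in> E1" "((y, b), t) \<in> E2" "ys = a + b"
    "s + t + c / 2 * (norm (y - z))\<^sup>2 + (norm a)\<^sup>2 / (2 * c) \<le> r"
    using p(1) unfolding pe by (rule reg_sum_epiE)
  obtain z' a' b' s' t' where q': "((z', a'), s') \<in> E1" "((y', b'), t') \<in> E2" "ys' = a' + b'"
    "s' + t' + c / 2 * (norm (y' - z'))\<^sup>2 + (norm a')\<^sup>2 / (2 * c) \<le> r'"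
    using p(2) unfolding pe' by (rule reg_sum_epiE)
  have yz: "(u *\<^sub>R y + v *\<^sub>R y') - (u *\<^sub>R z + v *\<^sub>R z') = u *\<^sub>R (y - z) + v *\<^sub>R (y' - z')"
    by (simp add: algebra_simps)
  have 1: "c / 2 * (norm ((u *\<^sub>R y + v *\<^sub>R y') - (u *\<^sub>R z + v *\<^sub>R z')))\<^sup>2
      \<le> c / 2 * (u * (norm (y - z))\<^sup>2 + v * (norm (y' - z'))\<^sup>2)"
    unfolding yz using c by (intro mult_left_mono norm_sq_convex uv) auto
  have 2: "(norm (u *\<^sub>R a + v *\<^sub>R a'))\<^sup>2 / (2 * c) \<le> (u * (norm a)\<^sup>2 + v * (norm a')\<^sup>2) / (2 * c)"
    using c by (intro divide_right_mono norm_sq_convex uv) auto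
  have 3: "u * (s + t + c / 2 * (norm (y - z))\<^sup>2 + (norm a)\<^sup>2 / (2 * c)) +
      v * (s' + t' + c / 2 * (norm (y' - z'))\<^sup>2 + (norm a')\<^sup>2 / (2 * c)) \<le> u * r + v * r'"
    by (intro add_mono mult_left_mono q(4) q'(4) uv)
  have 4: "(u * (norm a)\<^sup>2 + v * (norm a')\<^sup>2) / (2 * c) = u * ((norm a)\<^sup>2 / (2 * c)) + v * ((norm a')\<^sup>2 / (2 * c))"
    by (simp add: add_divide_distrib)
  have "(u * s + v * s') + (u * t + v * t') + c / 2 * (norm ((u *\<^sub>R y + v *\<^sub>R y') - (u *\<^sub>R z + v *\<^sub>R z')))\<^sup>2
      + (norm (u *\<^sub>R a + v *\<^sub>R a'))\<^sup>2 / (2 * c) \<le> u * r + v * r'"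
    using 1 2 3 unfolding 4 by (simp only: distrib_left mult.left_commute[of "c / 2"])
  from reg_sum_epiI[OF convexD_pairs[OF E(1) q(1) q'(1) uv] convexD_pairs[OF E(2) q(2) q'(2) uv] this]
  show "u *\<^sub>R p + v *\<^sub>R p' \<in> reg_sum_epi c E1 E2"
    by (simp add: pe pe' q(3) q'(3) algebra_simps)
qed

text \<open>Split \<open>ys y\<close> as \<open>a z + b y + a (y - z)\<close>. The two squares in
  the definition are conjugate to each other, so they absorb the last term.\<close>

lemma above_pairing_reg_sum_epi:
  assumes c: "c > 0" and E: "above_pairing E1" "above_pairing E2"
  shows "above_pairing (reg_sum_epi c E1 E2)"
  unfolding above_pairing_def
proof (intro allI impI)
  fix y ys r assume "((y, ys), r) \<in> reg_sum_epi c E1 E2"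
  then obtain z a b s t where q: "((z, a), s) \<in> E1" "((y, b), t) \<in> E2" "ys = a + b"
    "s + t + c / 2 * (norm (y - z))\<^sup>2 + (norm a)\<^sup>2 / (2 * c) \<le> r"
    by (rule reg_sum_epiE)
  have "blinfun_apply a z \<le> s" "blinfun_apply b y \<le> t" using q E unfolding above_pairing_def by blast+
  moreover have "a (y - z) \<le> c / 2 * (norm (y - z))\<^sup>2 + (norm a)\<^sup>2 / (2 * c)"
    using pairing_le_squares[OF c, of a "y - z"] by linarith
  ultimately show "ys y \<le> r" using q(3,4) by (simp add: blinfun.bilinear_simps)
qed

text \<open>Fenchel duality on two copies of X x X*: \<open>E\<close> keeps the summands uncoupled,
  and all coupling sits in \<open>g\<close>, which is continuous, so a multiplier exists. Its four
  components are reduced to \<open>l1\<close> and \<open>l2\<close>, because \<open>g\<close> is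
  only affine in the common point and in \<open>b\<close>.\<close>

lemma dual_above_pairing_reg_sum_epi:
  fixes E1 E2 :: "(('a::banach \<times> 'a dual) \<times> real) set"
  assumes c: "c > 0" and conv: "convex E1" "convex E2"
    and dual: "dual_above_pairing E1" "dual_above_pairing E2"
  shows "dual_above_pairing (reg_sum_epi c E1 E2)"
  unfolding dual_above_pairing_def
proof (intro allI impI, rule ccontr)
  fix Z :: "'a bidual" and xs :: "'a dual" and e :: real
  assume e: "e > 0"
    and "\<not> (\<exists>y ys r. ((y, ys), r) \<in> reg_sum_epi c E1 E2 \<and> r - Z ys - xs y \<le> - Z xs + e)"
  then have neg: "- Z xs + e < r - Z ys - xs y" if "((y, ys), r) \<in> reg_sum_epi c E1 E2" for y ys r
    using that by (meson not_le)
  define g where "g w = (c / 2 * (norm (fst (snd w) - fst (fst w)))\<^sup>2 + 1 / (2 * c) * (norm (snd (fst w)))\<^sup>2)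
      + (- Z (snd (fst w) + snd (snd w)) - xs (fst (snd w)))" for w :: "('a \<times> 'a dual) \<times> ('a \<times> 'a dual)"
  have g: "g ((z, a), (y, b)) = c / 2 * (norm (y - z))\<^sup>2 + (norm a)\<^sup>2 / (2 * c) - Z (a + b) - xs y" for z a y b
    by (simp add: g_def)
  define E where "E = {(((z, a), (y, b)), s + t) | z a s y b t. ((z, a), s) \<in> E1 \<and> ((y, b), t) \<in> E2}"
  have "convex E"
  proof (rule convexI)
    fix p p' :: "(('a \<times> 'a dual) \<times> ('a \<times> 'a dual)) \<times> real" and u v :: real
    assume p: "p \<in> E" "p' \<in> E" and uv: "0 \<le> u" "0 \<le> v" "u + v = 1"
    obtain z a s y b t where q: "p = (((z, a), (y, b)), s + t)" "((z, a), s) \<in> E1" "((y, b), t) \<in> E2"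
      using p(1) unfolding E_def by blast
    obtain z' a' s' y' b' t' where q': "p' = (((z', a'), (y', b')), s' + t')" "((z', a'), s') \<in> E1" "((y', b'), t') \<in> E2"
      using p(2) unfolding E_def by blast
    have "u *\<^sub>R p + v *\<^sub>R p' = (((u *\<^sub>R z + v *\<^sub>R z', u *\<^sub>R a + v *\<^sub>R a'), (u *\<^sub>R y + v *\<^sub>R y', u *\<^sub>R b + v *\<^sub>R b')),
        (u * s + v * s') + (u * t + v * t'))"
      by (simp add: q(1) q'(1) algebra_simps)
    then show "u *\<^sub>R p + v *\<^sub>R p' \<in> E"
      using convexD_pairs[OF conv(1) q(2) q'(2) uv] convexD_pairs[OF conv(2) q(3) q'(3) uv]
      unfolding E_def by blast
  qed
  moreover have "E \<noteq> {}"
  proof -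
    obtain z a s y b t where "((z, a), s) \<in> E1" "((y, b), t) \<in> E2"
      using dual_above_nonempty[OF dual(1)] dual_above_nonempty[OF dual(2)] by (metis ex_in_conv surj_pair)
    then show ?thesis unfolding E_def by blast
  qed
  moreover have "convex_on UNIV g"
    unfolding g_def
  proof (intro convex_on_add)
    show "convex_on UNIV (\<lambda>w :: ('a \<times> 'a dual) \<times> ('a \<times> 'a dual). c / 2 * (norm (fst (snd w) - fst (fst w)))\<^sup>2)"
      using c by (intro convex_on_norm_sq_affine[where h = "\<lambda>w. fst (snd w) - fst (fst w)"])
        (auto simp: algebra_simps)
    show "convex_on UNIV (\<lambda>w :: ('a \<times> 'a dual) \<times> ('a \<times> 'a dual). 1 / (2 * c) * (norm (snd (fst w)))\<^sup>2)"
      using c by (intro convex_on_norm_sq_affine[where h = "\<lambda>w. snd (fst w)"]) auto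
    show "convex_on UNIV (\<lambda>w :: ('a \<times> 'a dual) \<times> ('a \<times> 'a dual).
        - Z (snd (fst w) + snd (snd w)) - xs (fst (snd w)))"
      by (rule convex_onI) (auto simp: blinfun.bilinear_simps algebra_simps)
  qed
  moreover have "isCont g 0"
    unfolding g_def by (intro continuous_intros)
  moreover have "- Z xs + e \<le> r + g w" if wr: "(w, r) \<in> E" for w r
  proof -
    obtain z a s y b t where q: "w = ((z, a), (y, b))" "r = s + t" "((z, a), s) \<in> E1" "((y, b), t) \<in> E2"
      using wr unfolding E_def by blast
    show ?thesis using neg[OF reg_sum_epiI[OF q(3,4) order_refl]] by (simp add: q(1,2) g)
  qed
  ultimately obtain l where l: "\<And>w t w'. (w, t) \<in> E \<Longrightarrow> - Z xs + e \<le> t + blinfun_apply l w - l w' + g w'"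
    using sandwich_functional[of E g "- Z xs + e"] by blast
  obtain L1 L2 where L: "\<And>v w. l (v, w) = blinfun_apply L1 v + blinfun_apply L2 w"
    using blinfun_prod_split by blast
  obtain l1 l2 where l12: "\<And>z a. L1 (z, a) = blinfun_apply l1 z + blinfun_apply l2 a"
    using blinfun_prod_split by blast
  obtain l3 l4 where l34: "\<And>y b. L2 (y, b) = blinfun_apply l3 y + blinfun_apply l4 b"
    using blinfun_prod_split by blast
  \<comment> \<open>The test point \<open>((y' + u, a'), (y', b'))\<close> makes the quadratic
    depend on \<open>u\<close> and \<open>a'\<close> alone, while \<open>y'\<close> and
    \<open>b'\<close> enter linearly.\<close>
  have key: "- Z xs + e \<le> (s + l1 z + l2 a) + (t + l3 y + l4 b)
      + (c / 2 * (norm u)\<^sup>2 + (- l1) u) + ((1 / c) / 2 * (norm a')\<^sup>2 + (- (Z + l2)) a')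
      - (l1 + l3 + xs) y' - (l4 + Z) b'"
    if q: "((z, a), s) \<in> E1" "((y, b), t) \<in> E2" for z a s y b t u a' y' b'
  proof -
    have "(((z, a), (y, b)), s + t) \<in> E" using q unfolding E_def by blast
    from l[OF this, of "((y' + u, a'), (y', b'))"] show ?thesis
      by (simp add: g L l12 l34 blinfun.bilinear_simps algebra_simps)
  qed
  \<comment> \<open>Four approximations with error \<open>d\<close> each cost half of
    \<open>e\<close>.\<close>
  define d where "d = e / 8"
  have d: "d > 0" using e by (simp add: d_def)
  obtain z a s where q1: "((z, a), s) \<in> E1" "s + l2 a + l1 z \<le> - l2 l1 + d"
    using dual(1)[unfolded dual_above_pairing_def, rule_format, OF d, of "- l2" "- l1"]
    by (auto simp: blinfun.bilinear_simps)
  obtain y b t where q2: "((y, b), t) \<in> E2" "t + l4 b + l3 y \<le> - l4 l3 + d"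
    using dual(2)[unfolded dual_above_pairing_def, rule_format, OF d, of "- l4" "- l3"]
    by (auto simp: blinfun.bilinear_simps)
  \<comment> \<open>The left side is linear in the free variable \<open>y'\<close> and bounded
    above, so this functional is zero; likewise for \<open>b'\<close> below. These are the adjoint
    equations of the multiplier.\<close>
  have "(l1 + l3 + xs) y' \<le> (s + l1 z + l2 a) + (t + l3 y + l4 b) + Z xs - e" for y'
    using key[OF q1(1) q2(1), of 0 0 y' 0] by simp
  then have 13: "l1 + l3 + xs = 0" by (rule blinfun_eq_0_if_bounded_above)
  have "(l4 + Z) b' \<le> (s + l1 z + l2 a) + (t + l3 y + l4 b) + Z xs - e" for b'
    using key[OF q1(1) q2(1), of 0 0 0 b'] by simp
  then have "l4 + Z = 0" by (rule blinfun_eq_0_if_bounded_above)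
  then have l4: "l4 = - Z" by (simp add: eq_neg_iff_add_eq_0)
  have l3: "l3 = - l1 - xs" using 13 by (simp add: algebra_simps eq_neg_iff_add_eq_0)
  obtain u where u: "c / 2 * (norm u)\<^sup>2 + (- l1) u \<le> - (norm (- l1))\<^sup>2 / (2 * c) + d"
    using quadratic_near_min[OF c d] by blast
  have c': "1 / c > 0" using c by simp
  obtain a' where a': "(1 / c) / 2 * (norm a')\<^sup>2 + (- (Z + l2)) a' \<le> - (norm (- (Z + l2)))\<^sup>2 / (2 * (1 / c)) + d"
    using quadratic_near_min[OF c' d] by blast
  have young: "- (Z + l2) l1 \<le> (1 / c) / 2 * (norm l1)\<^sup>2 + (norm (Z + l2))\<^sup>2 / (2 * (1 / c))"
    using pairing_le_squares[OF c', of "Z + l2" l1] by linarith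
  have main: "- Z xs + e \<le> (- l2 l1 + d) + (Z l3 + d) + (- (norm l1)\<^sup>2 / (2 * c) + d)
      + (- (norm (Z + l2))\<^sup>2 / (2 * (1 / c)) + d)"
    using key[OF q1(1) q2(1), of u a' 0 0] q1(2) q2(2) u a'
    unfolding norm_minus_cancel by (simp add: l4 blinfun.bilinear_simps)
  have "- Z xs + e \<le> - Z xs + 4 * d"
    using main young by (simp add: l3 blinfun.bilinear_simps mult.commute)
  then show False using e by (simp add: d_def)
qed

text \<open>Here \<open>q w\<close> is the limit superior of \<open>f n w\<close>, which is
  sublinear, and \<open>a\<close> is a linear minorant of it. Such an \<open>a\<close> need not be a
  cluster point, but it inherits every limiting upper bound, and applied to \<open>- w\<close> every
  lower bound. One-sided inequalities of this kind are what membership in \<open>tilde T\<close> or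
  in a maximal monotone operator asks for.\<close>

lemma bounded_functionals_weak_star_cluster:
  fixes f :: "nat \<Rightarrow> 'a::real_normed_vector \<Rightarrow>\<^sub>L real"
  assumes M: "\<And>n. norm (f n) \<le> M"
  obtains a :: "'a \<Rightarrow>\<^sub>L real" where "\<forall>w c C. (\<forall>n. f n w \<le> c n) \<longrightarrow> c \<longlonglongrightarrow> C \<longrightarrow> a w \<le> C"
proof -
  define A where "A w = {c. \<forall>\<^sub>F n in sequentially. f n w \<le> c}" for w
  define q where "q w = Inf (A w)" for w
  have bd: "\<bar>f n w\<bar> \<le> M * norm w" for n w
    using norm_blinfun[of "f n" w] mult_right_mono[OF M[of n], of "norm w"] by simp
  have ne: "M * norm w \<in> A w" for w
    using bd[of _ w] by (auto simp: A_def abs_le_iff)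
  have low: "- (M * norm w) \<le> c" if "c \<in> A w" for w c
  proof -
    have "\<forall>\<^sub>F n in sequentially. f n w \<le> c" using that by (simp add: A_def)
    then obtain n where "f n w \<le> c" using eventually_happens'[OF sequentially_bot] by blast
    then show ?thesis using bd[of n w] by linarith
  qed
  have bdd: "bdd_below (A w)" for w using low by (rule bdd_belowI)
  have q_le: "q w \<le> c" if "c \<in> A w" for w c unfolding q_def by (rule cInf_lower[OF that bdd])
  have q_ge: "C \<le> q w" if "\<And>c. c \<in> A w \<Longrightarrow> C \<le> c" for C w
    unfolding q_def using ne that by (intro cInf_greatest) auto
  have sub: "sublinear q"
    unfolding sublinear_def
  proof (intro conjI allI impI)
    fix x y
    have *: "q (x + y) \<le> c + d" if "c \<in> A x" "d \<in> A y" for c d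
    proof (rule q_le)
      have "\<forall>\<^sub>F n in sequentially. f n x \<le> c" "\<forall>\<^sub>F n in sequentially. f n y \<le> d"
        using that by (simp_all add: A_def)
      then have "\<forall>\<^sub>F n in sequentially. f n (x + y) \<le> c + d"
        by eventually_elim (simp add: blinfun.add_right)
      then show "c + d \<in> A (x + y)" by (simp add: A_def)
    qed
    have "q (x + y) - c \<le> q y" if "c \<in> A x" for c
      using *[OF that] by (intro q_ge) (simp add: algebra_simps)
    then have "q (x + y) - q y \<le> q x" by (intro q_ge) (simp add: algebra_simps)
    then show "q (x + y) \<le> q x + q y" by linarith
  next
    fix r :: real and x assume r: "r > 0"
    have 1: "r * q x \<le> q (r *\<^sub>R x)" if r: "r > 0" for r x
    proof (rule q_ge)
      fix c assume "c \<in> A (r *\<^sub>R x)"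
      then have "c / r \<in> A x" using r by (simp add: A_def blinfun.scaleR_right field_simps)
      then show "r * q x \<le> c" using q_le[of "c / r" x] r by (simp add: field_simps)
    qed
    have "inverse r * q (r *\<^sub>R x) \<le> q x" using 1[of "inverse r" "r *\<^sub>R x"] r by simp
    then have "q (r *\<^sub>R x) \<le> r * q x" using r by (simp add: field_simps)
    then show "q (r *\<^sub>R x) = r * q x" using 1[OF r, of x] by linarith
  qed
  obtain h where h: "linear h" "\<And>x. h x \<le> q x" using Hahn_Banach_sublinear[OF sub] by blast
  have "bounded_linear h"
  proof (rule bounded_linear_if_bounded_above[OF h(1), of 1])
    fix x :: 'a assume x: "norm x \<le> 1"
    have "0 \<le> M" using M[of 0] norm_ge_zero order_trans by blast
    then have "M * norm x \<le> M" using x by (simp add: mult_left_le)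
    then show "h x \<le> M" using h(2)[of x] q_le[OF ne, of x] by linarith
  qed simp
  then have ap: "blinfun_apply (Blinfun h) = h" by (rule bounded_linear_Blinfun_apply)
  show ?thesis
  proof (rule that[of "Blinfun h"], intro allI impI)
    fix w and c :: "nat \<Rightarrow> real" and C assume le: "\<forall>n. f n w \<le> c n" and lim: "c \<longlonglongrightarrow> C"
    show "blinfun_apply (Blinfun h) w \<le> C"
      unfolding ap
    proof (rule field_le_epsilon)
      fix e :: real assume "e > 0"
      then have "\<forall>\<^sub>F n in sequentially. c n < C + e" using lim by (intro order_tendstoD(2)) auto
      then have "\<forall>\<^sub>F n in sequentially. f n w \<le> C + e"
        by eventually_elim (use le in \<open>metis less_imp_le order_trans\<close>)
      then show "h w \<le> C + e" using h(2)[of w] q_le[of "C + e" w] by (simp add: A_def)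
    qed
  qed
qed

subsection \<open>Fitzpatrick functions and type (D)\<close>

definition fitz_epi :: "('a::banach \<times> 'a dual) set \<Rightarrow> (('a \<times> 'a dual) \<times> real) set" where
  "fitz_epi T = {((x, xs), t). \<forall>(y, ys) \<in> T. blinfun_apply xs y + blinfun_apply ys x - blinfun_apply ys y \<le> t}"

lemma fitz_epiD:
  assumes "((x, xs), t) \<in> fitz_epi T" "(y, ys) \<in> T"
  shows "blinfun_apply xs y + blinfun_apply ys x - blinfun_apply ys y \<le> t"
  using assms unfolding fitz_epi_def by blast

lemma fitz_epiI:
  assumes "\<And>y ys. (y, ys) \<in> T \<Longrightarrow> blinfun_apply xs y + blinfun_apply ys x - blinfun_apply ys y \<le> t"
  shows "((x, xs), t) \<in> fitz_epi T"
  using assms unfolding fitz_epi_def by blast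

lemma convex_fitz_epi: "convex (fitz_epi T)"
proof (rule convexI)
  fix p p' :: "('a \<times> 'a dual) \<times> real" and u v :: real
  assume p: "p \<in> fitz_epi T" "p' \<in> fitz_epi T" and uv: "0 \<le> u" "0 \<le> v" "u + v = 1"
  obtain x xs s where e: "p = ((x, xs), s)" by (metis surj_pair)
  obtain x' xs' s' where e': "p' = ((x', xs'), s')" by (metis surj_pair)
  have "((u *\<^sub>R x + v *\<^sub>R x', u *\<^sub>R xs + v *\<^sub>R xs'), u * s + v * s') \<in> fitz_epi T"
  proof (rule fitz_epiI)
    fix y ys assume y: "(y, ys) \<in> T"
    have v: "v = 1 - u" using uv(3) by simp
    have "(u *\<^sub>R xs + v *\<^sub>R xs') y + ys (u *\<^sub>R x + v *\<^sub>R x') - ys y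
        = u * (xs y + ys x - ys y) + v * (xs' y + ys x' - ys y)"
      unfolding v by (simp add: blinfun.bilinear_simps algebra_simps)
    also have "\<dots> \<le> u * s + v * s'"
      using fitz_epiD[OF p(1)[unfolded e] y] fitz_epiD[OF p(2)[unfolded e'] y] uv
      by (intro add_mono mult_left_mono)
    finally show "(u *\<^sub>R xs + v *\<^sub>R xs') y + ys (u *\<^sub>R x + v *\<^sub>R x') - ys y \<le> u * s + v * s'" .
  qed
  then show "u *\<^sub>R p + v *\<^sub>R p' \<in> fitz_epi T" by (simp add: e e')
qed

lemma monotone_opD:
  "monotone_op T \<Longrightarrow> (x, xs) \<in> T \<Longrightarrow> (y, ys) \<in> T \<Longrightarrow> 0 \<le> blinfun_apply (xs - ys) (x - y)"
  unfolding monotone_op_def by blast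

lemma monotone_opI:
  assumes "\<And>x xs y ys. (x, xs) \<in> T \<Longrightarrow> (y, ys) \<in> T \<Longrightarrow> 0 \<le> blinfun_apply (xs - ys) (x - y)"
  shows "monotone_op T"
  using assms unfolding monotone_op_def by blast

lemma pairing_in_fitz_epi:
  assumes "monotone_op T" "(x, xs) \<in> T"
  shows "((x, xs), blinfun_apply xs x) \<in> fitz_epi T"
proof (rule fitz_epiI)
  fix y ys assume "(y, ys) \<in> T"
  from monotone_opD[OF assms this] show "xs y + ys x - ys y \<le> xs x"
    by (simp add: blinfun.bilinear_simps)
qed

lemma maximal_monotoneD:
  assumes T: "maximal_monotone T"
    and rel: "\<And>y ys. (y, ys) \<in> T \<Longrightarrow> 0 \<le> blinfun_apply (xs - ys) (x - y)"
  shows "(x, xs) \<in> T"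
proof -
  have mono: "monotone_op T" using T by (simp add: maximal_monotone_def)
  have "monotone_op (insert (x, xs) T)"
  proof (rule monotone_opI)
    fix y ys z zs assume "(y, ys) \<in> insert (x, xs) T" "(z, zs) \<in> insert (x, xs) T"
    then consider "(y, ys) = (x, xs)" "(z, zs) = (x, xs)" | "(y, ys) = (x, xs)" "(z, zs) \<in> T"
      | "(y, ys) \<in> T" "(z, zs) = (x, xs)" | "(y, ys) \<in> T" "(z, zs) \<in> T" by blast
    then show "0 \<le> (ys - zs) (y - z)"
    proof cases
      case 3
      have "(ys - zs) (y - z) = (zs - ys) (z - y)" by (simp add: blinfun.bilinear_simps)
      then show ?thesis using rel 3 by simp
    qed (use rel monotone_opD[OF mono] in auto)
  qed
  then have "insert (x, xs) T = T" using T unfolding maximal_monotone_def by blast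
  then show ?thesis by blast
qed

lemma maximal_monotoneI:
  assumes mono: "monotone_op T"
    and max: "\<And>x xs. (\<And>y ys. (y, ys) \<in> T \<Longrightarrow> 0 \<le> blinfun_apply (xs - ys) (x - y)) \<Longrightarrow> (x, xs) \<in> T"
  shows "maximal_monotone T"
  unfolding maximal_monotone_def
proof (intro conjI allI impI mono)
  fix S assume S: "monotone_op S \<and> T \<subseteq> S"
  have "(x, xs) \<in> T" if "(x, xs) \<in> S" for x xs
    using S that by (intro max) (blast dest: monotone_opD)
  then show "S = T" using S by auto
qed

text \<open>A value below the pairing would make \<open>(x, xs)\<close> related to all of
  \<open>T\<close>, hence a member of \<open>T\<close>; but at a member the supremum is at least the
  pairing.\<close>

lemma above_pairing_fitz_epi:
  assumes T: "maximal_monotone T"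
  shows "above_pairing (fitz_epi T)"
  unfolding above_pairing_def
proof (intro allI impI, rule ccontr)
  fix x xs t assume p: "((x, xs), t) \<in> fitz_epi T" and neg: "\<not> xs x \<le> t"
  have "(x, xs) \<in> T"
  proof (rule maximal_monotoneD[OF T])
    fix y ys assume "(y, ys) \<in> T"
    from fitz_epiD[OF p this] neg show "0 \<le> (xs - ys) (x - y)" by (simp add: blinfun.bilinear_simps)
  qed
  from fitz_epiD[OF p this] neg show False by simp
qed

lemma tildeD:
  "(z, xs) \<in> tilde T \<Longrightarrow> (y, ys) \<in> T \<Longrightarrow> blinfun_apply (xs - ys) y \<le> blinfun_apply z (xs - ys)"
  unfolding tilde_def by fastforce

lemma tildeI:
  assumes "\<And>y ys. (y, ys) \<in> T \<Longrightarrow> blinfun_apply (xs - ys) y \<le> blinfun_apply z (xs - ys)"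
  shows "(z, xs) \<in> tilde T"
  using assms unfolding tilde_def by fastforce

text \<open>Boundedness of the net yields the last limit: \<open>snd p - us\<close> tends to 0 in
  norm and is applied to bounded points, so the pairing converges although \<open>fst p\<close>
  converges only weak-star.\<close>

lemma type_D_limit:
  assumes T: "type_D T" and w: "(w, us) \<in> tilde T"
  obtains F where "F \<noteq> bot" "\<forall>\<^sub>F p in F. p \<in> T"
    "\<And>f. ((\<lambda>p. blinfun_apply f (fst p)) \<longlongrightarrow> blinfun_apply w f) F" "(snd \<longlongrightarrow> us) F"
    "((\<lambda>p. blinfun_apply (snd p) (fst p)) \<longlongrightarrow> blinfun_apply w us) F"
proof -
  obtain B F where F: "B \<subseteq> T" "bounded B" "F \<noteq> bot" "\<forall>\<^sub>F p in F. p \<in> B"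
    and lim: "\<And>f. ((\<lambda>p. blinfun_apply f (fst p)) \<longlongrightarrow> blinfun_apply w f) F" "(snd \<longlongrightarrow> us) F"
    using T w unfolding type_D_def by fastforce
  have inT: "\<forall>\<^sub>F p in F. p \<in> T" using F(4) by eventually_elim (use F(1) in blast)
  obtain M where M: "\<And>p. p \<in> B \<Longrightarrow> norm p \<le> M" using F(2) bounded_iff by blast
  have "((\<lambda>p. blinfun_apply (snd p - us) (fst p)) \<longlongrightarrow> 0) F"
  proof (rule Lim_null_comparison[where g = "\<lambda>p. norm (snd p - us) * M"])
    show "\<forall>\<^sub>F p in F. norm (blinfun_apply (snd p - us) (fst p)) \<le> norm (snd p - us) * M"
      using F(4)
    proof eventually_elim
      case (elim p)
      have "norm (fst p) \<le> M" using M[OF elim] norm_fst_le[of "fst p" "snd p"] by simp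
      then have "norm (snd p - us) * norm (fst p) \<le> norm (snd p - us) * M" by (intro mult_left_mono) auto
      then show ?case using norm_blinfun[of "snd p - us" "fst p"] by linarith
    qed
    have "((\<lambda>p. norm (snd p - us) * M) \<longlongrightarrow> norm (us - us) * M) F" by (intro tendsto_intros lim(2))
    then show "((\<lambda>p. norm (snd p - us) * M) \<longlongrightarrow> 0) F" by simp
  qed
  from tendsto_add[OF this lim(1)[of us]]
  have "((\<lambda>p. blinfun_apply (snd p) (fst p)) \<longlongrightarrow> w us) F" by (simp add: blinfun.bilinear_simps)
  then show ?thesis using that[OF F(3) inT lim] by blast
qed

lemma fitz_epi_tilde:
  assumes T: "type_D T" and w: "(w, us) \<in> tilde T" and p: "((z, a), s) \<in> fitz_epi T"
  shows "blinfun_apply w a + blinfun_apply us z - blinfun_apply w us \<le> s"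
proof -
  obtain F where F: "F \<noteq> bot" "\<forall>\<^sub>F p in F. p \<in> T"
    "\<And>f. ((\<lambda>p. blinfun_apply f (fst p)) \<longlongrightarrow> blinfun_apply w f) F" "(snd \<longlongrightarrow> us) F"
    "((\<lambda>p. blinfun_apply (snd p) (fst p)) \<longlongrightarrow> blinfun_apply w us) F"
    using type_D_limit[OF T w] by blast
  have "((\<lambda>p. a (fst p) + blinfun_apply (snd p) z - blinfun_apply (snd p) (fst p)) \<longlongrightarrow> w a + us z - w us) F"
    by (intro tendsto_add tendsto_diff F(3,5) blinfun.tendsto F(4) tendsto_const)
  moreover have "\<forall>\<^sub>F q in F. a (fst q) + blinfun_apply (snd q) z - blinfun_apply (snd q) (fst q) \<le> s"
    using F(2) by eventually_elim (use fitz_epiD[OF p] in \<open>metis prod.collapse\<close>)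
  ultimately show ?thesis using F(1) tendsto_upperbound by blast
qed

text \<open>Membership in \<open>tilde T\<close> compares a point with \<open>T\<close> only.
  Approximating the second point by a net in \<open>T\<close> transfers the comparison to two points
  of \<open>tilde T\<close>.\<close>

lemma monotone_tilde:
  assumes T: "type_D T" and z: "(z, xs) \<in> tilde T" and w: "(w, ys) \<in> tilde T"
  shows "0 \<le> blinfun_apply (z - w) (xs - ys)"
proof -
  obtain F where F: "F \<noteq> bot" "\<forall>\<^sub>F p in F. p \<in> T"
    "\<And>f. ((\<lambda>p. blinfun_apply f (fst p)) \<longlongrightarrow> blinfun_apply w f) F" "(snd \<longlongrightarrow> ys) F"
    "((\<lambda>p. blinfun_apply (snd p) (fst p)) \<longlongrightarrow> blinfun_apply w ys) F"
    using type_D_limit[OF T w] by blast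
  have "((\<lambda>p. z (xs - snd p) - (xs (fst p) - blinfun_apply (snd p) (fst p))) \<longlongrightarrow> z (xs - ys) - (w xs - w ys)) F"
    by (intro tendsto_diff F(3,5) blinfun.tendsto F(4) tendsto_const)
  moreover have "\<forall>\<^sub>F p in F. 0 \<le> z (xs - snd p) - (xs (fst p) - blinfun_apply (snd p) (fst p))"
    using F(2)
  proof eventually_elim
    case (elim p)
    then show ?case using tildeD[OF z, of "fst p" "snd p"] by (simp add: blinfun.bilinear_simps)
  qed
  ultimately have "0 \<le> z (xs - ys) - (w xs - w ys)" using F(1) tendsto_lowerbound by blast
  then show ?thesis by (simp add: blinfun.bilinear_simps)
qed

text \<open>Outside \<open>tilde T\<close> a violating point of \<open>T\<close> already lies
  strictly below the required value. On \<open>tilde T\<close> the values along the type (D) net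
  converge to \<open>- z xs\<close>.\<close>

lemma type_D_dual_above_pairing:
  fixes T :: "('a::banach \<times> 'a dual) set"
  assumes T: "type_D T"
  shows "dual_above_pairing (fitz_epi T)"
  unfolding dual_above_pairing_def
proof (intro allI impI)
  fix z :: "'a bidual" and xs :: "'a dual" and e :: real assume e: "e > 0"
  have mono: "monotone_op T" using T by (simp add: type_D_def maximal_monotone_def)
  have "\<exists>y ys. (y, ys) \<in> T \<and> ys y - z ys - xs y \<le> - z xs + e"
  proof (cases "(z, xs) \<in> tilde T")
    case False
    then obtain y ys where y: "(y, ys) \<in> T" "z (xs - ys) < (xs - ys) y"
      using tildeI by (metis not_le)
    then show ?thesis using e by (intro exI[of _ y] exI[of _ ys]) (simp add: blinfun.bilinear_simps)
  next
    case True
    obtain F where F: "F \<noteq> bot" "\<forall>\<^sub>F p in F. p \<in> T"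
      "\<And>f. ((\<lambda>p. blinfun_apply f (fst p)) \<longlongrightarrow> blinfun_apply z f) F" "(snd \<longlongrightarrow> xs) F"
      "((\<lambda>p. blinfun_apply (snd p) (fst p)) \<longlongrightarrow> blinfun_apply z xs) F"
      using type_D_limit[OF T True] by blast
    have "((\<lambda>p. blinfun_apply (snd p) (fst p) - z (snd p) - xs (fst p)) \<longlongrightarrow> z xs - z xs - z xs) F"
      by (intro tendsto_diff F(3,5) blinfun.tendsto F(4) tendsto_const)
    then have "\<forall>\<^sub>F p in F. blinfun_apply (snd p) (fst p) - z (snd p) - xs (fst p) < - z xs + e"
      using e by (intro order_tendstoD(2)) auto
    with F(2) have "\<forall>\<^sub>F p in F. p \<in> T \<and> blinfun_apply (snd p) (fst p) - z (snd p) - xs (fst p) < - z xs + e"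
      by eventually_elim simp
    then obtain p where "p \<in> T \<and> blinfun_apply (snd p) (fst p) - z (snd p) - xs (fst p) < - z xs + e"
      using eventually_happens'[OF F(1)] by blast
    then show ?thesis by (intro exI[of _ "fst p"] exI[of _ "snd p"]) simp
  qed
  then show "\<exists>y ys t. ((y, ys), t) \<in> fitz_epi T \<and> t - z ys - xs y \<le> - z xs + e"
    using pairing_in_fitz_epi[OF mono] by blast
qed

subsection \<open>Moreau--Yosida regularisations and their sums\<close>

text \<open>The Fitzpatrick epigraph of the zero operator, which makes \<open>T\<^sub>\<lambda>\<close> the special case \<open>B = 0\<close> of
  \<open>T\<^sub>\<lambda> + B\<close>.\<close>

definition zero_epi :: "(('a::banach \<times> 'a dual) \<times> real) set" where
  "zero_epi = {((y, b), t). b = 0 \<and> 0 \<le> t}"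

lemma convex_zero_epi: "convex (zero_epi :: (('a::banach \<times> 'a dual) \<times> real) set)"
  unfolding zero_epi_def by (rule convexI) auto

lemma above_pairing_zero_epi: "above_pairing zero_epi"
  unfolding above_pairing_def zero_epi_def by auto

lemma dual_above_pairing_zero_epi: "dual_above_pairing (zero_epi :: (('a::banach \<times> 'a dual) \<times> real) set)"
  unfolding dual_above_pairing_def
proof (intro allI impI)
  fix z :: "'a bidual" and xs :: "'a dual" and e :: real assume e: "e > 0"
  have "\<exists>y. z xs \<le> xs y"
  proof (rule ccontr)
    assume "\<not> ?thesis"
    then have less: "xs y < z xs" for y by (simp add: not_le)
    then have "xs = 0" by (intro blinfun_eq_0_if_bounded_above[of xs "z xs"] less_imp_le)
    then show False using less[of 0] by simp
  qed
  then obtain y where "z xs \<le> xs y" by blast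
  then show "\<exists>y ys t. ((y, ys), t) \<in> zero_epi \<and> t - z ys - xs y \<le> - z xs + e"
    using e by (intro exI[of _ y] exI[of _ 0]) (simp add: zero_epi_def)
qed

definition yosida_epi :: "('a::banach \<times> 'a dual) set \<Rightarrow> real \<Rightarrow> (('a \<times> 'a dual) \<times> real) set" where
  "yosida_epi T lam = reg_sum_epi (1 / lam) (fitz_epi T) zero_epi"

lemma yosidaE:
  assumes "(x, xs) \<in> yosida T lam" "lam > 0"
  obtains z where "(z, xs) \<in> tilde T" "(z - canon x, - (lam *\<^sub>R xs)) \<in> tilde duality_map"
  using assms unfolding yosida_def by auto

lemma yosidaI:
  assumes "(z, xs) \<in> tilde T" "(z - canon x, - (lam *\<^sub>R xs)) \<in> tilde duality_map" "lam > 0"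
  shows "(x, xs) \<in> yosida T lam"
  using assms unfolding yosida_def by auto

lemma monotone_tilde_duality_map:
  assumes "(z, xs) \<in> tilde duality_map" "(w, ys) \<in> tilde duality_map"
  shows "0 \<le> blinfun_apply (z - w) (xs - ys)"
  using tilde_duality_map_norms[OF assms(1)] tilde_duality_map_norms[OF assms(2)]
    Fenchel_Young(1)[of z ys] Fenchel_Young(1)[of w xs]
  by (simp add: blinfun.bilinear_simps)

text \<open>Decompose \<open>x - y\<close> through the resolvent points as
  \<open>(z - w) - ((z - x) - (w - y))\<close>: the first part is monotone against
  \<open>xs - ys\<close> by \<open>tilde T\<close>, the second by the duality map at
  \<open>- lam xs\<close>.\<close>

lemma monotone_yosida:
  assumes T: "type_D T" and lam: "lam > 0"
  shows "monotone_op (yosida T lam)"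
proof (rule monotone_opI)
  fix x xs y ys assume "(x, xs) \<in> yosida T lam" "(y, ys) \<in> yosida T lam"
  then obtain z w where z: "(z, xs) \<in> tilde T" "(z - canon x, - (lam *\<^sub>R xs)) \<in> tilde duality_map"
    and w: "(w, ys) \<in> tilde T" "(w - canon y, - (lam *\<^sub>R ys)) \<in> tilde duality_map"
    using lam by (meson yosidaE)
  have "0 \<le> lam * blinfun_apply (z - w) (xs - ys)" using monotone_tilde[OF T z(1) w(1)] lam by simp
  moreover have "0 \<le> blinfun_apply ((z - canon x) - (w - canon y)) (- (lam *\<^sub>R xs) - - (lam *\<^sub>R ys))"
    by (rule monotone_tilde_duality_map[OF z(2) w(2)])
  ultimately have "0 \<le> lam * (xs - ys) (x - y)"
    by (simp add: blinfun.bilinear_simps algebra_simps)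
  then show "0 \<le> (xs - ys) (x - y)" using lam by (simp add: zero_le_mult_iff)
qed

text \<open>At \<open>(u, us)\<close> with resolvent point \<open>w\<close>, add the extended
  Fitzpatrick inequality at \<open>(w, us)\<close> and Young's inequality for \<open>us\<close> with
  \<open>y - z\<close> and for \<open>w - u\<close> with \<open>a\<close>. The squares of
  \<open>w - u\<close> and \<open>us\<close> that remain are paid for by Fenchel equality at
  \<open>w - u\<close>.\<close>

lemma yosida_epi_subset_fitz_epi:
  assumes T: "type_D T" and lam: "lam > 0"
  shows "yosida_epi T lam \<subseteq> fitz_epi (yosida T lam)"
proof
  fix p assume p: "p \<in> yosida_epi T lam"
  obtain y a r where pe: "p = ((y, a), r)" by (metis surj_pair)
  have "((y, a), r) \<in> reg_sum_epi (1 / lam) (fitz_epi T) zero_epi" using p by (simp add: pe yosida_epi_def)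
  then obtain z a' b s t where q: "((z, a'), s) \<in> fitz_epi T" "((y, b), t) \<in> zero_epi" "a = a' + b"
      "s + t + (1 / lam) / 2 * (norm (y - z))\<^sup>2 + (norm a')\<^sup>2 / (2 * (1 / lam)) \<le> r"
    by (rule reg_sum_epiE)
  have b: "b = 0" "0 \<le> t" using q(2) by (simp_all add: zero_epi_def)
  have a: "a' = a" using q(3) b by simp
  have qq: "s + (1 / lam) / 2 * (norm (y - z))\<^sup>2 + (norm a)\<^sup>2 / (2 * (1 / lam)) \<le> r" using q(4) b a by simp
  show "p \<in> fitz_epi (yosida T lam)"
    unfolding pe
  proof (rule fitz_epiI)
    fix u us assume "(u, us) \<in> yosida T lam"
    then obtain w where w: "(w, us) \<in> tilde T" "(w - canon u, - (lam *\<^sub>R us)) \<in> tilde duality_map"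
      using lam by (rule yosidaE)
    have "(1/2) * (norm (w - canon u))\<^sup>2 + (1/2) * (norm (- (lam *\<^sub>R us)))\<^sup>2 \<le> (w - canon u) (- (lam *\<^sub>R us))"
      by (rule tilde_duality_map_norms[OF w(2)])
    then have "(1/2) * (norm (w - canon u))\<^sup>2 + lam * (lam / 2 * (norm us)\<^sup>2) \<le> lam * (us u - w us)"
      by (simp add: blinfun.bilinear_simps power_mult_distrib power2_eq_square algebra_simps)
    then have 1: "(norm (w - canon u))\<^sup>2 / (2 * lam) + lam / 2 * (norm us)\<^sup>2 \<le> us u - w us"
      using lam by (simp add: field_simps)
    have 2: "us (y - z) \<le> (1 / lam) / 2 * (norm (y - z))\<^sup>2 + (norm us)\<^sup>2 / (2 * (1 / lam))"
      using pairing_le_squares[of "1 / lam" us "y - z"] lam by simp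
    have 3: "- (w - canon u) a \<le> lam / 2 * (norm a)\<^sup>2 + (norm (w - canon u))\<^sup>2 / (2 * lam)"
      using pairing_le_squares[OF lam, of "w - canon u" a] by linarith
    have 4: "w a + us z - w us \<le> s" using fitz_epi_tilde[OF T w(1) q(1)] by (simp add: a)
    have 5: "(norm us)\<^sup>2 / (2 * (1 / lam)) = lam / 2 * (norm us)\<^sup>2" "(norm a)\<^sup>2 / (2 * (1 / lam)) = lam / 2 * (norm a)\<^sup>2"
      by simp_all
    have 6: "- (w - canon u) a = a u - w a" "us (y - z) = us y - us z"
      by (simp_all add: blinfun.bilinear_simps)
    show "a u + us y - us u \<le> r"
      using 1 2 3 4 qq unfolding 5 6 by argo
  qed
qed

section \<open>Bounded decompositions of contact points\<close>

lemma quadratic_bound: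
  fixes p q K k :: real
  assumes p: "p > 0" and q: "q > 0" and K: "K \<ge> 0" "k \<ge> 0"
  obtains M where "\<And>x y. x \<ge> 0 \<Longrightarrow> y \<ge> 0 \<Longrightarrow> p * x\<^sup>2 + q * y\<^sup>2 \<le> K + k * (x + y) \<Longrightarrow> x \<le> M \<and> y \<le> M"
proof -
  define m where "m = min p q"
  have m: "m > 0" "m \<le> p" "m \<le> q" using p q by (auto simp: m_def)
  have "x + y \<le> 1 + 2 * (K + k) / m" if xy: "x \<ge> 0" "y \<ge> 0" "p * x\<^sup>2 + q * y\<^sup>2 \<le> K + k * (x + y)" for x y
  proof (cases "x + y \<le> 1")
    case True
    then show ?thesis using m K by (simp add: add_increasing2)
  next
    case False
    define w where "w = x + y"
    have w: "w > 1" using False by (simp add: w_def)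
    have "m * x\<^sup>2 \<le> p * x\<^sup>2" "m * y\<^sup>2 \<le> q * y\<^sup>2" using m by (auto intro!: mult_right_mono)
    moreover have "w\<^sup>2 \<le> 2 * (x\<^sup>2 + y\<^sup>2)"
      using zero_le_power2[of "x - y"] by (simp add: w_def power2_eq_square algebra_simps)
    then have "m / 2 * w\<^sup>2 \<le> m / 2 * (2 * (x\<^sup>2 + y\<^sup>2))" using m by (intro mult_left_mono) auto
    ultimately have "m / 2 * w\<^sup>2 \<le> K + k * w" using xy(3) by (simp add: w_def algebra_simps)
    also have "\<dots> \<le> (K + k) * w" using w mult_left_mono[of 1 w K] K by (simp add: algebra_simps)
    finally have "(m / 2 * w) * w \<le> (K + k) * w" by (simp add: power2_eq_square algebra_simps)
    then have "m / 2 * w \<le> K + k" using w by (simp add: mult_le_cancel_right)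
    then have "w \<le> 2 * (K + k) / m" using m by (simp add: field_simps)
    then show ?thesis by (simp add: w_def)
  qed
  note le = this
  show ?thesis
  proof (rule that[of "1 + 2 * (K + k) / m"])
    fix x y :: real assume xy: "x \<ge> 0" "y \<ge> 0" "p * x\<^sup>2 + q * y\<^sup>2 \<le> K + k * (x + y)"
    from le[OF xy] xy(1,2) show "x \<le> 1 + 2 * (K + k) / m \<and> y \<le> 1 + 2 * (K + k) / m" by linarith
  qed
qed

text \<open>The last two premises are affine minorants of \<open>s\<close> and \<open>t\<close>, as
  supplied by single points of the operators. The quadratic coupling outgrows them, so bounds on
  \<open>y\<close>, on the sum \<open>a + b\<close> and on the total value bound the components
  too.\<close>

lemma reg_sum_components_bounded:
  fixes v w :: "'a::banach" and vs ws :: "'a dual"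
  assumes c: "c > 0" and N: "N \<ge> 0"
  obtains M where "\<And>y z a b s t. norm y \<le> N \<Longrightarrow> norm (a + b) \<le> N \<Longrightarrow>
     s + t + c / 2 * (norm (y - z))\<^sup>2 + (norm a)\<^sup>2 / (2 * c) \<le> N \<Longrightarrow>
     blinfun_apply a v + blinfun_apply vs z - k1 \<le> s \<Longrightarrow>
     blinfun_apply b w + blinfun_apply ws y - k2 \<le> t \<Longrightarrow> norm z \<le> M \<and> norm a \<le> M"
proof -
  define K where "K = N + \<bar>k1\<bar> + \<bar>k2\<bar> + norm vs * N + N * norm w + norm ws * N"
  define k where "k = norm v + norm vs + norm w"
  have K: "K \<ge> 0" "k \<ge> 0" using N by (auto simp: K_def k_def)
  have "c / 2 > 0" "1 / (2 * c) > 0" using c by auto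
  then obtain M where M: "\<And>x y. x \<ge> 0 \<Longrightarrow> y \<ge> 0 \<Longrightarrow> c / 2 * x\<^sup>2 + 1 / (2 * c) * y\<^sup>2 \<le> K + k * (x + y) \<Longrightarrow> x \<le> M \<and> y \<le> M"
    using quadratic_bound[OF _ _ K] by blast
  have "norm z \<le> M + N \<and> norm a \<le> M + N"
    if h: "norm y \<le> N" "norm (a + b) \<le> N" "s + t + c / 2 * (norm (y - z))\<^sup>2 + (norm a)\<^sup>2 / (2 * c) \<le> N"
      "a v + vs z - k1 \<le> s" "b w + ws y - k2 \<le> t"
    for y z :: 'a and a b :: "'a dual" and s t
  proof -
    define r where "r = norm (y - z)"
    have bd: "- (norm f * norm x) \<le> f x" for f :: "'a dual" and x
      using norm_blinfun[of f x] by simp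
    have 1: "- (norm a * norm v) \<le> a v" by (rule bd)
    have 2: "- (norm vs * (N + r)) \<le> vs z"
    proof -
      have "norm z \<le> N + r" using norm_triangle_ineq2[of z y] h(1) by (simp add: r_def norm_minus_commute)
      then have "norm vs * norm z \<le> norm vs * (N + r)" by (intro mult_left_mono) auto
      then show ?thesis using bd[of vs z] by linarith
    qed
    have 3: "- ((N + norm a) * norm w) \<le> b w"
    proof -
      have "norm b \<le> N + norm a" using norm_triangle_ineq4[of "a + b" a] h(2) by simp
      then have "norm b * norm w \<le> (N + norm a) * norm w" by (intro mult_right_mono) auto
      then show ?thesis using bd[of b w] by linarith
    qed
    have 4: "- (norm ws * N) \<le> ws y"
      using bd[of ws y] mult_left_mono[OF h(1), of "norm ws"] by simp
    have r0: "r \<ge> 0" by (simp add: r_def)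
    have nn: "0 \<le> norm v * r" "0 \<le> norm w * r" "0 \<le> norm vs * norm a" using r0 by auto
    have "c / 2 * r\<^sup>2 + 1 / (2 * c) * (norm a)\<^sup>2 \<le> N - s - t" using h(3) by (simp add: r_def)
    also have "\<dots> \<le> N + k1 + k2 + norm a * norm v + norm vs * (N + r) + (N + norm a) * norm w + norm ws * N"
      using 1 2 3 4 h(4,5) by linarith
    also have "\<dots> \<le> K + k * (r + norm a)"
    proof -
      have "K + k * (r + norm a) = N + \<bar>k1\<bar> + \<bar>k2\<bar> + norm a * norm v + norm vs * (N + r)
          + (N + norm a) * norm w + norm ws * N + (norm v * r + norm w * r + norm vs * norm a)"
        by (simp add: K_def k_def algebra_simps)
      then show ?thesis using nn by linarith
    qed
    finally have "r \<le> M \<and> norm a \<le> M" using M[OF r0 norm_ge_zero] by blast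
    moreover have "norm z \<le> N + r" using norm_triangle_ineq2[of z y] h(1) by (simp add: r_def norm_minus_commute)
    ultimately show ?thesis using N by linarith
  qed
  then show ?thesis by (rule that)
qed

lemma convergent_norm_bound:
  fixes f :: "nat \<Rightarrow> 'a::real_normed_vector"
  assumes "f \<longlonglongrightarrow> L"
  obtains N where "N \<ge> 0" "\<And>n. norm (f n) \<le> N"
proof -
  have "Bseq f" using assms convergent_imp_Bseq convergentI by blast
  then obtain N where "N > 0" "\<And>n. norm (f n) \<le> N" unfolding Bseq_def by blast
  then show ?thesis by (intro that[of N]) auto
qed

text \<open>\<open>E2\<close> enters through one affine minorant, which serves both
  \<open>zero_epi\<close> and the Fitzpatrick epigraph of a second operator.\<close>

lemma reg_sum_contact_sequences:
  fixes T :: "('a::banach \<times> 'a dual) set"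
  assumes c: "c > 0" and p: "(x, xs) \<in> contact_set (reg_sum_epi c (fitz_epi T) E2)"
    and v: "(v, vs) \<in> T"
    and E2: "\<And>y b t. ((y, b), t) \<in> E2 \<Longrightarrow> blinfun_apply b w + blinfun_apply ws y - k \<le> t"
  obtains z a s y b t r M
  where "\<forall>n. ((z n, a n), s n) \<in> fitz_epi T" "\<forall>n. ((y n, b n), t n) \<in> E2"
    "\<forall>n. s n + t n + c / 2 * (norm (y n - z n))\<^sup>2 + (norm (a n))\<^sup>2 / (2 * c) \<le> r n"
    "y \<longlonglongrightarrow> x" "(\<lambda>n. a n + b n) \<longlonglongrightarrow> xs" "r \<longlonglongrightarrow> xs x"
    "\<forall>n. norm (z n) \<le> M" "\<forall>n. norm (a n) \<le> M"
proof -
  have "((x, xs), xs x) \<in> closure (reg_sum_epi c (fitz_epi T) E2)"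
    using p by (simp add: contact_set_def)
  then obtain P where P: "\<And>n. P n \<in> reg_sum_epi c (fitz_epi T) E2" "P \<longlonglongrightarrow> ((x, xs), xs x)"
    unfolding closure_sequential by blast
  define y where "y n = fst (fst (P n))" for n
  define ys where "ys n = snd (fst (P n))" for n
  define r where "r n = snd (P n)" for n
  have lim: "y \<longlonglongrightarrow> x" "ys \<longlonglongrightarrow> xs" "r \<longlonglongrightarrow> xs x"
    using tendsto_fst[OF tendsto_fst[OF P(2)]] tendsto_snd[OF tendsto_fst[OF P(2)]] tendsto_snd[OF P(2)]
    unfolding y_def ys_def r_def by simp_all
  have "((y n, ys n), r n) \<in> reg_sum_epi c (fitz_epi T) E2" for n
    using P(1)[of n] by (simp add: y_def ys_def r_def)
  then have "\<forall>n. \<exists>z a b s t. ((z, a), s) \<in> fitz_epi T \<and> ((y n, b), t) \<in> E2 \<and> ys n = a + b \<and>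
      s + t + c / 2 * (norm (y n - z))\<^sup>2 + (norm a)\<^sup>2 / (2 * c) \<le> r n"
    unfolding reg_sum_epi_def by blast
  then obtain z a b s t where q: "\<And>n. ((z n, a n), s n) \<in> fitz_epi T" "\<And>n. ((y n, b n), t n) \<in> E2"
      "\<And>n. ys n = a n + b n"
      "\<And>n. s n + t n + c / 2 * (norm (y n - z n))\<^sup>2 + (norm (a n))\<^sup>2 / (2 * c) \<le> r n"
    by metis
  obtain N1 where N1: "N1 \<ge> 0" "\<And>n. norm (y n) \<le> N1" using convergent_norm_bound[OF lim(1)] by blast
  obtain N2 where N2: "N2 \<ge> 0" "\<And>n. norm (ys n) \<le> N2" using convergent_norm_bound[OF lim(2)] by blast
  obtain N3 where N3: "N3 \<ge> 0" "\<And>n. norm (r n) \<le> N3" using convergent_norm_bound[OF lim(3)] by blast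
  define N where "N = N1 + N2 + N3"
  have "N \<ge> 0" using N1(1) N2(1) N3(1) by (simp add: N_def)
  then obtain M where M: "\<And>y z a b s t. norm y \<le> N \<Longrightarrow> norm (a + b) \<le> N \<Longrightarrow>
     s + t + c / 2 * (norm (y - z))\<^sup>2 + (norm a)\<^sup>2 / (2 * c) \<le> N \<Longrightarrow>
     blinfun_apply a v + blinfun_apply vs z - blinfun_apply vs v \<le> s \<Longrightarrow>
     blinfun_apply b w + blinfun_apply ws y - k \<le> t \<Longrightarrow> norm z \<le> M \<and> norm a \<le> M"
    using reg_sum_components_bounded[OF c] by blast
  have bd: "norm (z n) \<le> M \<and> norm (a n) \<le> M" for n
  proof (rule M)
    show "norm (y n) \<le> N" using N1(2)[of n] N2(1) N3(1) by (simp add: N_def)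
    show "norm (a n + b n) \<le> N" using N2(2)[of n] N1(1) N3(1) by (simp add: N_def q(3))
    show "s n + t n + c / 2 * (norm (y n - z n))\<^sup>2 + (norm (a n))\<^sup>2 / (2 * c) \<le> N"
      using q(4)[of n] N3(2)[of n] N1(1) N2(1) by (simp add: N_def)
    show "a n v + vs (z n) - vs v \<le> s n" by (rule fitz_epiD[OF q(1) v])
    show "b n w + ws (y n) - k \<le> t n" by (rule E2[OF q(2)])
  qed
  have "ys = (\<lambda>n. a n + b n)" using q(3) by blast
  with lim(2) have "(\<lambda>n. a n + b n) \<longlonglongrightarrow> xs" by simp
  then show ?thesis using that[of z a s y b t r M] q(1,2,4) lim(1,3) bd by blast
qed

lemma blinfun_apply_le_norm_bound:
  fixes f :: "'a::real_normed_vector \<Rightarrow>\<^sub>L real"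
  assumes "norm x \<le> M"
  shows "f x \<le> norm f * M"
  using norm_blinfun[of f x] mult_left_mono[OF assms norm_ge_zero[of f]] by simp

lemma norm_canon_le: "norm (canon x) \<le> norm x"
proof (rule norm_blinfun_bound)
  fix f show "norm (canon x f) \<le> norm x * norm f"
    using norm_blinfun[of f x] by (simp add: mult.commute)
qed simp

lemma maximal_monotone_nonempty: "maximal_monotone T \<Longrightarrow> \<exists>v vs. (v, vs) \<in> T"
  using maximal_monotoneD[of T] by metis

text \<open>The excess \<open>e n\<close> dominates a sum of three nonnegative parts:
  \<open>s n - a n (z n)\<close>, \<open>t n\<close>, and the Fenchel-Young defect of
  \<open>y n - z n\<close> with \<open>a n\<close>. As it tends to 0, the first part puts the bidual
  limit \<open>Z\<close> of the \<open>z n\<close> over \<open>xs\<close> into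
  \<open>tilde T\<close>, and the last one yields the duality condition.\<close>

lemma contact_set_yosida_epi:
  assumes T: "type_D T" and lam: "lam > 0"
  shows "contact_set (yosida_epi T lam) \<subseteq> yosida T lam"
proof
  fix p assume p: "p \<in> contact_set (yosida_epi T lam)"
  obtain x xs where pe: "p = (x, xs)" by (metis surj_pair)
  have max: "maximal_monotone T" using T by (simp add: type_D_def)
  obtain v vs where v: "(v, vs) \<in> T" using maximal_monotone_nonempty[OF max] by blast
  have c: "1 / lam > 0" using lam by simp
  have p': "(x, xs) \<in> contact_set (reg_sum_epi (1 / lam) (fitz_epi T) zero_epi)"
    using p by (simp add: pe yosida_epi_def)
  have E2: "blinfun_apply b 0 + blinfun_apply 0 y - 0 \<le> t" if "((y, b), t) \<in> zero_epi"
    for y :: 'a and b :: "'a dual" and t using that by (simp add: zero_epi_def)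
  obtain y z a b s t r M where Q: "\<forall>n. ((z n, a n), s n) \<in> fitz_epi T" "\<forall>n. ((y n, b n), t n) \<in> zero_epi"
    "\<forall>n. s n + t n + (1 / lam) / 2 * (norm (y n - z n))\<^sup>2 + (norm (a n))\<^sup>2 / (2 * (1 / lam)) \<le> r n"
    "y \<longlonglongrightarrow> x" "(\<lambda>n. a n + b n) \<longlonglongrightarrow> xs" "r \<longlonglongrightarrow> xs x"
    "\<forall>n. norm (z n) \<le> M" "\<forall>n. norm (a n) \<le> M"
    using reg_sum_contact_sequences[OF c p' v E2] .
  note q = Q(1-3)[rule_format] Q(4-6) Q(7,8)[rule_format]
  have b: "b n = 0" "t n \<ge> 0" for n using q(2)[of n] by (simp_all add: zero_epi_def)
  have a_lim: "a \<longlonglongrightarrow> xs" using q(5) by (simp add: b)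
  define e where "e n = r n - a n (y n)" for n
  have "(\<lambda>n. r n - a n (y n)) \<longlonglongrightarrow> xs x - xs x"
    by (intro tendsto_diff q(6) blinfun.tendsto a_lim q(4))
  then have e_lim: "e \<longlonglongrightarrow> 0" by (simp add: e_def[abs_def])
  have above: "a n (z n) \<le> s n" for n
    using above_pairing_fitz_epi[OF max] q(1)[of n] by (auto simp: above_pairing_def)
  have cb: "norm (canon (z n)) \<le> M" for n using norm_canon_le[of "z n"] q(7)[of n] by linarith
  obtain Z where "\<forall>f c C. (\<forall>n. canon (z n) f \<le> c n) \<longrightarrow> c \<longlonglongrightarrow> C \<longrightarrow> blinfun_apply Z f \<le> C"
    using bounded_functionals_weak_star_cluster[OF cb] .
  then have Z: "Z f \<le> C" if "\<And>n. blinfun_apply f (z n) \<le> c n" "c \<longlonglongrightarrow> C" for f c C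
    using that unfolding canon_apply by blast
  have tilde: "(Z, xs) \<in> tilde T"
  proof (rule tildeI)
    fix u us assume u: "(u, us) \<in> T"
    \<comment> \<open>The vanishing terms are written out so that the right side is, term by term,
      the limit of the bound for \<open>z n\<close>.\<close>
    have "Z (us - xs) \<le> 0 + norm (xs - xs) * M - xs u + us u"
    proof (rule Z)
      fix n
      have "a n (y n - z n) \<le> (1 / lam) / 2 * (norm (y n - z n))\<^sup>2 + (norm (a n))\<^sup>2 / (2 * (1 / lam))"
        using pairing_le_squares[OF c, of "a n" "y n - z n"] by linarith
      then have "s n \<le> e n + a n (z n)"
        using q(3)[of n] b(2)[of n] by (simp add: e_def blinfun.bilinear_simps)
      moreover have "a n u + us (z n) - us u \<le> s n" by (rule fitz_epiD[OF q(1) u])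
      moreover have "(a n - xs) (z n) \<le> norm (a n - xs) * M" by (rule blinfun_apply_le_norm_bound[OF q(7)])
      ultimately show "(us - xs) (z n) \<le> e n + norm (a n - xs) * M - a n u + us u"
        by (simp add: blinfun.bilinear_simps)
    qed (intro tendsto_intros e_lim a_lim)
    then show "(xs - us) u \<le> Z (xs - us)" by (simp add: blinfun.bilinear_simps)
  qed
  have dual: "(Z - canon x, - (lam *\<^sub>R xs)) \<in> tilde duality_map"
  proof (rule tildeI)
    fix u us assume u: "(u, us) \<in> (duality_map :: ('a \<times> 'a dual) set)"
    have "Z (us + lam *\<^sub>R xs) \<le> (us + lam *\<^sub>R xs) x + lam * 0 + lam * (norm (xs - xs) * M + (xs - xs) x) + us u + lam * xs u"
    proof (rule Z)
      fix n
      define w where "w = z n - y n"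
      have "(1/2) * (norm u)\<^sup>2 + us (w - u) \<le> (1/2) * (norm w)\<^sup>2"
        using u by (simp add: duality_map_def subdiff_def)
      moreover have "(- (lam *\<^sub>R a n)) u \<le> (1/2) * (norm u)\<^sup>2 + (1/2) * (norm (- (lam *\<^sub>R a n)))\<^sup>2"
        by (rule Fenchel_Young(1))
      moreover have "(1/2) * (norm w)\<^sup>2 + (1/2) * (norm (- (lam *\<^sub>R a n)))\<^sup>2
          = lam * ((1 / lam) / 2 * (norm (y n - z n))\<^sup>2 + (norm (a n))\<^sup>2 / (2 * (1 / lam)))"
        using lam by (simp add: w_def norm_minus_commute power_mult_distrib power2_eq_square field_simps)
      moreover have "lam * ((1 / lam) / 2 * (norm (y n - z n))\<^sup>2 + (norm (a n))\<^sup>2 / (2 * (1 / lam)))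
          \<le> lam * (e n - a n w)"
        using lam q(3)[of n] b(2)[of n] above[of n]
        by (intro mult_left_mono) (simp_all add: e_def w_def blinfun.bilinear_simps)
      ultimately have 1: "us w - us u - lam * a n u \<le> lam * (e n - a n w)"
        by (simp add: blinfun.bilinear_simps)
      have "(xs - a n) (z n) \<le> norm (xs - a n) * M" by (rule blinfun_apply_le_norm_bound[OF q(7)])
      then have "lam * ((xs - a n) (z n)) \<le> lam * (norm (xs - a n) * M)" using lam by simp
      with 1 show "(us + lam *\<^sub>R xs) (z n) \<le> (us + lam *\<^sub>R xs) (y n) + lam * e n +
          lam * (norm (xs - a n) * M + (a n - xs) (y n)) + us u + lam * a n u"
        by (simp add: w_def blinfun.bilinear_simps algebra_simps)
    qed (intro tendsto_intros e_lim a_lim q(4))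
    then show "(- (lam *\<^sub>R xs) - us) u \<le> (Z - canon x) (- (lam *\<^sub>R xs) - us)"
      by (simp add: blinfun.bilinear_simps algebra_simps)
  qed
  show "p \<in> yosida T lam" unfolding pe by (rule yosidaI[OF tilde dual lam])
qed

section \<open>Maximality of the regularisations and solvability of the sums\<close>

lemma yosida_epi_properties:
  assumes T: "type_D T" and lam: "lam > 0"
  shows "convex (yosida_epi T lam)" "above_pairing (yosida_epi T lam)" "dual_above_pairing (yosida_epi T lam)"
proof -
  have c: "1 / lam > 0" using lam by simp
  have max: "maximal_monotone T" using T by (simp add: type_D_def)
  show "convex (yosida_epi T lam)"
    unfolding yosida_epi_def by (intro convex_reg_sum_epi c convex_fitz_epi convex_zero_epi)
  show "above_pairing (yosida_epi T lam)"
    unfolding yosida_epi_def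
    by (intro above_pairing_reg_sum_epi c above_pairing_fitz_epi max above_pairing_zero_epi)
  show "dual_above_pairing (yosida_epi T lam)"
    unfolding yosida_epi_def
    by (intro dual_above_pairing_reg_sum_epi c convex_fitz_epi convex_zero_epi
        type_D_dual_above_pairing T dual_above_pairing_zero_epi)
qed

text \<open>The contact set is nearly solvable and contained in the monotone regularisation, so a
  point related to the latter is already a contact point.\<close>

lemma maximal_monotone_yosida:
  assumes T: "type_D T" and lam: "lam \<ge> 0"
  shows "maximal_monotone (yosida T lam)"
proof (cases "lam = 0")
  case True
  then show ?thesis using T by (simp add: yosida_def type_D_def)
next
  case False
  then have lam: "lam > 0" using lam by simp
  show ?thesis
  proof (rule maximal_monotoneI[OF monotone_yosida[OF T lam]])
    fix x :: 'a and xs :: "'a dual"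
    assume rel: "\<And>y ys. (y, ys) \<in> yosida T lam \<Longrightarrow> 0 \<le> (xs - ys) (x - y)"
    have "(x, xs) \<in> contact_set (yosida_epi T lam)"
    proof (rule contact_set_maximal)
      show "near_solvable (contact_set (yosida_epi T lam))"
        by (intro near_solvable_contact_set yosida_epi_properties T lam)
      fix y ys assume "(y, ys) \<in> contact_set (yosida_epi T lam)"
      then have "0 \<le> (xs - ys) (x - y)" using contact_set_yosida_epi[OF T lam] rel by blast
      then show "0 \<le> (ys - xs) (y - x)" by (simp add: blinfun.bilinear_simps)
    qed
    then show "(x, xs) \<in> yosida T lam" using contact_set_yosida_epi[OF T lam] by blast
  qed
qed

lemma dual_above_pairing_yosida:
  assumes T: "type_D T" and lam: "lam \<ge> 0"
  shows "dual_above_pairing (fitz_epi (yosida T lam))"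
proof (cases "lam = 0")
  case True
  then show ?thesis using type_D_dual_above_pairing[OF T] by (simp add: yosida_def)
next
  case False
  then have lam: "lam > 0" using lam by simp
  \<comment> \<open>The property only asks for points to exist, so it passes to the larger
    epigraph.\<close>
  show ?thesis
    using yosida_epi_properties(3)[OF T lam] yosida_epi_subset_fitz_epi[OF T lam]
    unfolding dual_above_pairing_def by (meson subsetD)
qed

text \<open>Both excesses are nonnegative and their sum is at most \<open>e n\<close>, so each tends
  to 0 separately. The points \<open>y n\<close> converge in norm and the \<open>a n\<close> are
  bounded, so the weak-star type limit \<open>A\<close> passes through the pairings, and maximality
  of both summands identifies the limits.\<close>

lemma contact_set_yosida_sum:
  assumes T: "type_D T" and lam: "lam > 0" and B: "maximal_monotone B"
  shows "contact_set (reg_sum_epi (1 / lam) (fitz_epi T) (fitz_epi B)) \<subseteq> op_sum (yosida T lam) B"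
proof
  fix p assume p: "p \<in> contact_set (reg_sum_epi (1 / lam) (fitz_epi T) (fitz_epi B))"
  obtain x xs where pe: "p = (x, xs)" by (metis surj_pair)
  have max: "maximal_monotone T" using T by (simp add: type_D_def)
  have maxA: "maximal_monotone (yosida T lam)" using maximal_monotone_yosida[OF T] lam by simp
  obtain v vs where v: "(v, vs) \<in> T" using maximal_monotone_nonempty[OF max] by blast
  obtain w ws where w: "(w, ws) \<in> B" using maximal_monotone_nonempty[OF B] by blast
  have c: "1 / lam > 0" using lam by simp
  obtain y z a b s t r M where Q: "\<forall>n. ((z n, a n), s n) \<in> fitz_epi T" "\<forall>n. ((y n, b n), t n) \<in> fitz_epi B"
    "\<forall>n. s n + t n + (1 / lam) / 2 * (norm (y n - z n))\<^sup>2 + (norm (a n))\<^sup>2 / (2 * (1 / lam)) \<le> r n"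
    "y \<longlonglongrightarrow> x" "(\<lambda>n. a n + b n) \<longlonglongrightarrow> xs" "r \<longlonglongrightarrow> xs x"
    "\<forall>n. norm (z n) \<le> M" "\<forall>n. norm (a n) \<le> M"
    using reg_sum_contact_sequences[OF c p[unfolded pe] v fitz_epiD[OF _ w]] .
  note q = Q(1-3)[rule_format] Q(4-6) Q(7,8)[rule_format]
  \<comment> \<open>The whole quadratic term is charged to the regularised summand, which turns the
    decomposition into one for its Fitzpatrick function and that of \<open>B\<close>.\<close>
  define R where "R n = s n + (1 / lam) / 2 * (norm (y n - z n))\<^sup>2 + (norm (a n))\<^sup>2 / (2 * (1 / lam))" for n
  have inA: "((y n, a n), R n) \<in> fitz_epi (yosida T lam)" for n
  proof -
    have "((y n, 0), 0) \<in> zero_epi" by (simp add: zero_epi_def)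
    from reg_sum_epiI[where c = "1 / lam" and r = "R n", OF q(1) this]
    have "((y n, a n), R n) \<in> yosida_epi T lam" by (simp add: yosida_epi_def R_def)
    then show ?thesis using yosida_epi_subset_fitz_epi[OF T lam] by blast
  qed
  have lowA: "a n (y n) \<le> R n" and lowB: "b n (y n) \<le> t n" for n
    using above_pairing_fitz_epi[OF maxA] inA[of n] above_pairing_fitz_epi[OF B] q(2)[of n]
    unfolding above_pairing_def by blast+
  define e where "e n = r n - (a n + b n) (y n)" for n
  have "(\<lambda>n. r n - (a n + b n) (y n)) \<longlonglongrightarrow> xs x - xs x"
    by (intro tendsto_diff q(6) blinfun.tendsto q(4,5))
  then have e_lim: "e \<longlonglongrightarrow> 0" by (simp add: e_def[abs_def])
  have sum: "R n + t n \<le> r n" for n using q(3)[of n] by (simp add: R_def)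
  have upA: "R n \<le> a n (y n) + e n" and upB: "t n \<le> b n (y n) + e n" for n
    using sum[of n] lowA[of n] lowB[of n] by (simp_all add: e_def blinfun.bilinear_simps)
  obtain A where "\<forall>u c C. (\<forall>n. blinfun_apply (a n) u \<le> c n) \<longrightarrow> c \<longlonglongrightarrow> C \<longrightarrow> blinfun_apply A u \<le> C"
    using bounded_functionals_weak_star_cluster[OF q(8)] .
  then have A: "A u \<le> C" if "\<And>n. blinfun_apply (a n) u \<le> c n" "c \<longlonglongrightarrow> C" for u c C
    using that by blast
  have "(x, A) \<in> yosida T lam"
  proof (rule maximal_monotoneD[OF maxA])
    fix u us assume u: "(u, us) \<in> yosida T lam"
    have "A (u - x) \<le> M * norm (x - x) + 0 + us u - us x"
    proof (rule A)
      fix n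
      have "a n u + us (y n) - us u \<le> R n" by (rule fitz_epiD[OF inA u])
      moreover have "a n (y n - x) \<le> M * norm (y n - x)"
        using norm_blinfun[of "a n" "y n - x"] mult_right_mono[OF q(8)[of n] norm_ge_zero[of "y n - x"]] by simp
      ultimately show "a n (u - x) \<le> M * norm (y n - x) + e n + us u - us (y n)"
        using upA[of n] by (simp add: blinfun.bilinear_simps)
    qed (intro tendsto_intros e_lim q(4))
    then show "0 \<le> (A - us) (x - u)" by (simp add: blinfun.bilinear_simps)
  qed
  \<comment> \<open>Since \<open>a n + b n\<close> converges in norm, the limit for
    \<open>b n\<close> is \<open>xs - A\<close>, and bounds on \<open>b n\<close> are rewritten as
    bounds on \<open>a n\<close>.\<close>
  moreover have "(x, xs - A) \<in> B"
  proof (rule maximal_monotoneD[OF B])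
    fix u us assume u: "(u, us) \<in> B"
    have "A (x - u) \<le> M * norm (x - x) + 0 + us u - us x + xs (x - u)"
    proof (rule A)
      fix n
      have "b n u + us (y n) - us u \<le> t n" by (rule fitz_epiD[OF q(2) u])
      moreover have "a n (x - y n) \<le> M * norm (x - y n)"
        using norm_blinfun[of "a n" "x - y n"] mult_right_mono[OF q(8)[of n] norm_ge_zero[of "x - y n"]] by simp
      ultimately show "a n (x - u) \<le> M * norm (x - y n) + e n + us u - us (y n) + (a n + b n) (y n - u)"
        using upB[of n] by (simp add: blinfun.bilinear_simps)
    qed (intro tendsto_add tendsto_diff tendsto_mult tendsto_norm blinfun.tendsto tendsto_const e_lim q(4,5))
    then show "0 \<le> (xs - A - us) (x - u)" by (simp add: blinfun.bilinear_simps)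
  qed
  ultimately have "(x, A + (xs - A)) \<in> op_sum (yosida T lam) B" unfolding op_sum_def by blast
  then show "p \<in> op_sum (yosida T lam) B" by (simp add: pe)
qed

lemma near_solvable_yosida_sum:
  assumes T: "type_D T" and lam: "lam > 0"
    and B: "maximal_monotone B" "dual_above_pairing (fitz_epi B)"
  shows "near_solvable (op_sum (yosida T lam) B)"
proof -
  have c: "1 / lam > 0" using lam by simp
  have max: "maximal_monotone T" using T by (simp add: type_D_def)
  have "near_solvable (contact_set (reg_sum_epi (1 / lam) (fitz_epi T) (fitz_epi B)))"
    by (intro near_solvable_contact_set convex_reg_sum_epi above_pairing_reg_sum_epi
        dual_above_pairing_reg_sum_epi c convex_fitz_epi above_pairing_fitz_epi max
        type_D_dual_above_pairing T B)
  then show ?thesis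
    using contact_set_yosida_sum[OF T lam B(1)] unfolding near_solvable_def by (meson subsetD)
qed

lemma op_sum_commute: "op_sum A B = op_sum B A"
proof -
  have "op_sum A B \<subseteq> op_sum B A" for A B :: "('a \<times> 'a dual) set"
    unfolding op_sum_def using add.commute by blast
  then show ?thesis by blast
qed

lemma monotone_op_sum:
  assumes "monotone_op A" "monotone_op B"
  shows "monotone_op (op_sum A B)"
proof (rule monotone_opI)
  fix x xs y ys assume "(x, xs) \<in> op_sum A B" "(y, ys) \<in> op_sum A B"
  then obtain a b a' b' where ab: "xs = a + b" "ys = a' + b'" "(x, a) \<in> A" "(x, b) \<in> B" "(y, a') \<in> A" "(y, b') \<in> B"
    unfolding op_sum_def by blast
  from monotone_opD[OF assms(1) ab(3,5)] monotone_opD[OF assms(2) ab(4,6)]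
  show "0 \<le> (xs - ys) (x - y)" by (simp add: ab(1,2) blinfun.bilinear_simps)
qed

lemma yosida_sum_monotone_near_solvable:
  assumes T: "type_D T1" "type_D T2" and lm: "l \<ge> 0" "m \<ge> 0" "l + m > 0"
  shows "monotone_op (op_sum (yosida T1 l) (yosida T2 m))"
    and "near_solvable (op_sum (yosida T1 l) (yosida T2 m))"
proof -
  note max = maximal_monotone_yosida[OF T(1) lm(1)] maximal_monotone_yosida[OF T(2) lm(2)]
  note dual = dual_above_pairing_yosida[OF T(1) lm(1)] dual_above_pairing_yosida[OF T(2) lm(2)]
  show "monotone_op (op_sum (yosida T1 l) (yosida T2 m))"
    using max by (intro monotone_op_sum) (simp_all add: maximal_monotone_def)
  show "near_solvable (op_sum (yosida T1 l) (yosida T2 m))"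
  \<comment> \<open>The positive parameter selects the operator that supplies the quadratic
    coupling; the other may be 0, where \<open>yosida\<close> is the operator itself.\<close>
  proof (cases "l > 0")
    case True
    then show ?thesis by (rule near_solvable_yosida_sum[OF T(1) _ max(2) dual(2)])
  next
    case False
    then have "m > 0" using lm by simp
    then have "near_solvable (op_sum (yosida T2 m) (yosida T1 l))"
      by (rule near_solvable_yosida_sum[OF T(2) _ max(1) dual(1)])
    then show ?thesis by (simp add: op_sum_commute)
  qed
qed

subsection \<open>Lower limits of representing epigraphs\<close>

definition seq_lower_limit :: "(nat \<Rightarrow> 'b::metric_space set) \<Rightarrow> 'b set" where
  "seq_lower_limit C = {p. \<exists>c. (\<forall>n. c n \<in> C n) \<and> c \<longlonglongrightarrow> p}"

lemma seq_lower_limitI: "(\<And>n. c n \<in> C n) \<Longrightarrow> c \<longlonglongrightarrow> p \<Longrightarrow> p \<in> seq_lower_limit C"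
  unfolding seq_lower_limit_def by blast

text \<open>With membership expressed by distances, closedness of the limit follows from the
  triangle inequality for \<open>infdist\<close> and needs no diagonal selection.\<close>

lemma seq_lower_limit_infdist:
  assumes ne: "\<And>n. C n \<noteq> {}"
  shows "p \<in> seq_lower_limit C \<longleftrightarrow> (\<lambda>n. infdist p (C n)) \<longlonglongrightarrow> 0"
proof
  assume "p \<in> seq_lower_limit C"
  then obtain c where c: "\<And>n. c n \<in> C n" "c \<longlonglongrightarrow> p" by (auto simp: seq_lower_limit_def)
  have lim: "(\<lambda>n. dist (c n) p) \<longlonglongrightarrow> 0" using c(2) tendsto_dist_iff by blast
  have le: "norm (infdist p (C n)) \<le> dist (c n) p" for n
    using infdist_le[OF c(1), of p n] infdist_nonneg[of p "C n"] by (simp add: dist_commute)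
  show "(\<lambda>n. infdist p (C n)) \<longlonglongrightarrow> 0"
    by (rule Lim_null_comparison[OF _ lim]) (simp only: le eventually_True)
next
  assume lim: "(\<lambda>n. infdist p (C n)) \<longlonglongrightarrow> 0"
  have "\<exists>c. c \<in> C n \<and> dist p c < infdist p (C n) + inverse (real (Suc n))" for n
    using infdist_notempty[OF ne[of n], of p] cINF_less_iff[of "C n" "\<lambda>a. dist p a"] ne[of n]
    by (metis bdd_belowI2 less_add_same_cancel1 inverse_positive_iff_positive of_nat_0_less_iff zero_less_Suc zero_le_dist)
  then obtain c where c: "\<And>n. c n \<in> C n" "\<And>n. dist p (c n) < infdist p (C n) + inverse (real (Suc n))"
    by metis
  have lim': "(\<lambda>n. infdist p (C n) + inverse (real (Suc n))) \<longlonglongrightarrow> 0"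
    using tendsto_add[OF lim LIMSEQ_inverse_real_of_nat] by simp
  have le: "norm (dist (c n) p) \<le> infdist p (C n) + inverse (real (Suc n))" for n
    using c(2)[of n] by (simp add: dist_commute)
  have "(\<lambda>n. dist (c n) p) \<longlonglongrightarrow> 0"
    by (rule Lim_null_comparison[OF _ lim']) (simp only: le eventually_True)
  then have "c \<longlonglongrightarrow> p" using tendsto_dist_iff by blast
  then show "p \<in> seq_lower_limit C" using c(1) by (auto simp: seq_lower_limit_def)
qed

lemma closed_seq_lower_limit:
  assumes ne: "\<And>n. C n \<noteq> {}"
  shows "closed (seq_lower_limit C)"
  unfolding closed_sequential_limits
proof (intro allI impI, elim conjE)
  fix x l assume x: "\<forall>k. x k \<in> seq_lower_limit C" and lim: "x \<longlonglongrightarrow> l"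
  show "l \<in> seq_lower_limit C"
    unfolding seq_lower_limit_infdist[of C, OF ne]
  proof (rule LIMSEQ_I)
    fix e :: real assume e: "e > 0"
    obtain k where k: "dist (x k) l < e / 2" using lim e unfolding lim_sequentially by (meson half_gt_zero order_refl)
    have "(\<lambda>n. infdist (x k) (C n)) \<longlonglongrightarrow> 0" using x seq_lower_limit_infdist[of C, OF ne] by simp
    then obtain n0 where n0: "\<And>n. n \<ge> n0 \<Longrightarrow> norm (infdist (x k) (C n) - 0) < e / 2"
      using LIMSEQ_D[of _ 0 "e / 2"] e by (metis half_gt_zero)
    have "norm (infdist l (C n) - 0) < e" if "n \<ge> n0" for n
      using n0[OF that] k infdist_triangle[of l "C n" "x k"] infdist_nonneg[of l "C n"]
      by (simp add: dist_commute)
    then show "\<exists>n0. \<forall>n\<ge>n0. norm (infdist l (C n) - 0) < e" by blast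
  qed
qed

lemma convex_seq_lower_limit:
  fixes C :: "nat \<Rightarrow> 'b::real_normed_vector set"
  assumes "\<And>n. convex (C n)"
  shows "convex (seq_lower_limit C)"
proof (rule convexI)
  fix p q :: 'b and u v :: real
  assume "p \<in> seq_lower_limit C" "q \<in> seq_lower_limit C" and uv: "0 \<le> u" "0 \<le> v" "u + v = 1"
  then obtain c d where c: "\<And>n. c n \<in> C n" "c \<longlonglongrightarrow> p" and d: "\<And>n. d n \<in> C n" "d \<longlonglongrightarrow> q"
    by (auto simp: seq_lower_limit_def)
  have "u *\<^sub>R c n + v *\<^sub>R d n \<in> C n" for n by (rule convexD[OF assms c(1) d(1) uv])
  moreover have "(\<lambda>n. u *\<^sub>R c n + v *\<^sub>R d n) \<longlonglongrightarrow> u *\<^sub>R p + v *\<^sub>R q"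
    by (intro tendsto_intros c d)
  ultimately show "u *\<^sub>R p + v *\<^sub>R q \<in> seq_lower_limit C"
    by (rule seq_lower_limitI)
qed

section \<open>Representability from closed convex epigraphs\<close>

lemma representable_of_epigraph:
  fixes E :: "(('a::banach \<times> 'a dual) \<times> real) set"
  assumes conv: "convex E" and cl: "closed E" and ne: "E \<noteq> {}" and above: "above_pairing E"
    and up: "\<And>p t t'. (p, t) \<in> E \<Longrightarrow> t \<le> t' \<Longrightarrow> (p, t') \<in> E"
  shows "representable {(x, xs). ((x, xs), blinfun_apply xs x) \<in> E}"
proof -
  define h where "h p = (INF t\<in>{t. (p, t) \<in> E}. ereal t)" for p
  have h_le: "h p \<le> ereal t \<longleftrightarrow> (p, t) \<in> E" for p t
  proof
    assume "(p, t) \<in> E"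
    then show "h p \<le> ereal t" unfolding h_def by (intro INF_lower) simp
  next
    assume le: "h p \<le> ereal t"
    \<comment> \<open>The infimum need not be attained a priori; upward closure places every larger
      height in \<open>E\<close>, and closedness then adds \<open>t\<close> itself.\<close>
    have "(p, t + inverse (real (Suc n))) \<in> E" for n
    proof -
      have "h p < ereal (t + inverse (real (Suc n)))"
        using le by (rule le_less_trans) simp
      then obtain t' where "(p, t') \<in> E" "t' < t + inverse (real (Suc n))"
        unfolding h_def INF_less_iff by auto
      then show ?thesis using up by (meson less_imp_le)
    qed
    moreover have "(\<lambda>n. (p, t + inverse (real (Suc n)))) \<longlonglongrightarrow> (p, t + 0)"
      by (intro tendsto_Pair tendsto_add tendsto_const LIMSEQ_inverse_real_of_nat)
    ultimately show "(p, t) \<in> E" using closed_sequentially[OF cl] by (metis add_0_right)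
  qed
  have pair: "ereal (blinfun_apply xs x) \<le> h (x, xs)" for x xs
    unfolding h_def using above unfolding above_pairing_def by (intro INF_greatest) simp
  have notminf: "h p \<noteq> - \<infinity>" for p using pair[of "snd p" "fst p"] by auto
  have "monotone_op {(x, xs). ((x, xs), blinfun_apply xs x) \<in> E}"
  proof (rule monotone_opI)
    fix x xs y ys
    assume "(x, xs) \<in> {(x, xs). ((x, xs), blinfun_apply xs x) \<in> E}" "(y, ys) \<in> {(x, xs). ((x, xs), blinfun_apply xs x) \<in> E}"
    then have "((x, xs), xs x) \<in> E" "((y, ys), ys y) \<in> E" by simp_all
    from pairing_diff_lower_bound[OF conv above this] show "0 \<le> (xs - ys) (x - y)" by simp
  qed
  moreover have "convex_ereal h" using conv by (simp add: convex_ereal_def h_le)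
  moreover have "proper_fun h"
  proof -
    obtain p t where "(p, t) \<in> E" using ne by auto
    then have "h p \<le> ereal t" by (simp add: h_le)
    then have "h p \<noteq> \<infinity>" by auto
    then show ?thesis using notminf unfolding proper_fun_def by blast
  qed
  moreover have "lsc_fun h"
    unfolding lsc_fun_def
  proof
    fix c show "closed {p. h p \<le> c}"
    proof (cases c)
      case (real r)
      have "closed ((\<lambda>p. (p, r)) -` E)"
        by (rule continuous_closed_vimage[OF cl]) (intro continuous_intros)
      then show ?thesis by (simp add: real h_le vimage_def)
    qed (use notminf in auto)
  qed
  moreover have "((x, xs), blinfun_apply xs x) \<in> E \<longleftrightarrow> h (x, xs) = ereal (blinfun_apply xs x)" for x xs
    using h_le[of "(x, xs)" "blinfun_apply xs x"] pair[of xs x] by auto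
  ultimately show ?thesis
    unfolding representable_def using pair by (intro conjI exI[of _ h]) auto
qed

text \<open>An empty intersection of epigraphs gives no proper function. The sum of the half squares
  plus 1 is proper and stays strictly above the pairing.\<close>

lemma representable_empty: "representable ({} :: ('a::banach \<times> 'a dual) set)"
proof -
  let ?E = "{((x :: 'a, xs :: 'a dual), t). ((x, xs), t - 1) \<in> half_sq_epi}"
  have E: "?E = (\<lambda>p. p - ((0, 0), 1)) -` half_sq_epi" by (auto simp: zero_prod_def[symmetric])
  have "representable {(x, xs). ((x, xs), blinfun_apply xs x) \<in> ?E}"
  proof (rule representable_of_epigraph)
    show "convex ?E"
    proof -
      have "?E = (\<lambda>p. ((0, 0), 1) + p) ` half_sq_epi"
      proof (intro set_eqI iffI)
        fix p assume "p \<in> ?E"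
        then have "p - ((0, 0), 1) \<in> half_sq_epi" unfolding E by simp
        then show "p \<in> (\<lambda>p. ((0, 0), 1) + p) ` half_sq_epi"
          by (intro image_eqI[of _ _ "p - ((0, 0), 1)"]) auto
      next
        fix p assume "p \<in> (\<lambda>p. ((0, 0), 1) + p) ` (half_sq_epi :: (('a \<times> 'a dual) \<times> real) set)"
        then show "p \<in> ?E" unfolding E by auto
      qed
      then show ?thesis using convex_translation[OF convex_half_sq_epi, of "((0, 0), 1)"] by simp
    qed
    show "closed ?E"
      unfolding E by (rule continuous_closed_vimage[OF closed_half_sq_epi]) (intro continuous_intros)
    have "((0, 0), 1) \<in> ?E" by (simp add: half_sq_epi_def)
    then show "?E \<noteq> {}" by blast
    show "above_pairing ?E"
      unfolding above_pairing_def
    proof (intro allI impI)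
      fix x :: 'a and xs :: "'a dual" and t assume "((x, xs), t) \<in> ?E"
      then show "xs x \<le> t" using Fenchel_Young(1)[of xs x] by (simp add: half_sq_epi_def)
    qed
    show "(p, t') \<in> ?E" if "(p, t) \<in> ?E" "t \<le> t'" for p t t'
      using that by (cases p) (simp add: half_sq_epi_def)
  qed
  moreover have "((x, xs), blinfun_apply xs x) \<notin> ?E" for x xs
    using Fenchel_Young(1)[of xs x] by (simp add: half_sq_epi_def)
  then have "{(x, xs). ((x, xs), blinfun_apply xs x) \<in> ?E} = {}" by blast
  ultimately show ?thesis by simp
qed

text \<open>Near solvability takes the place of maximality here: for the regularised sums it is the
  property that has been established.\<close>

lemma fitz_epi_above_pairing_near_solvable:
  assumes "near_solvable S"
  shows "above_pairing (fitz_epi S)"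
  unfolding above_pairing_def
proof (intro allI impI)
  fix x xs t assume p: "((x, xs), t) \<in> fitz_epi S"
  show "xs x \<le> t"
  proof (rule field_le_epsilon)
    fix e :: real assume "e > 0"
    then obtain y ys where y: "(y, ys) \<in> S" "gap x xs y ys \<le> e"
      using assms unfolding near_solvable_def by blast
    have "(ys - xs) (y - x) \<le> e"
      using y(2) zero_le_power2[of "norm (y - x)"] zero_le_power2[of "norm (ys - xs)"] unfolding gap_def by argo
    then show "xs x \<le> t + e"
      using fitz_epiD[OF p y(1)] by (simp add: blinfun.bilinear_simps)
  qed
qed

lemma lower_limit_contact:
  assumes mono: "\<And>n. monotone_op (S n)" and solv: "\<And>n. near_solvable (S n)"
  shows "(x, xs) \<in> lower_limit S \<longleftrightarrow> ((x, xs), blinfun_apply xs x) \<in> seq_lower_limit (\<lambda>n. fitz_epi (S n))"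
proof
  assume "(x, xs) \<in> lower_limit S"
  then obtain y ys where y: "\<And>n. (y n, ys n) \<in> S n" "y \<longlonglongrightarrow> x" "ys \<longlonglongrightarrow> xs"
    by (auto simp: lower_limit_def)
  have "((y n, ys n), ys n (y n)) \<in> fitz_epi (S n)" for n by (rule pairing_in_fitz_epi[OF mono y(1)])
  moreover have "(\<lambda>n. ((y n, ys n), ys n (y n))) \<longlonglongrightarrow> ((x, xs), xs x)"
    by (intro tendsto_Pair blinfun.tendsto y)
  ultimately show "((x, xs), xs x) \<in> seq_lower_limit (\<lambda>n. fitz_epi (S n))"
    by (rule seq_lower_limitI)
next
  assume "((x, xs), xs x) \<in> seq_lower_limit (\<lambda>n. fitz_epi (S n))"
  then obtain P where P: "\<And>n. P n \<in> fitz_epi (S n)" "P \<longlonglongrightarrow> ((x, xs), xs x)"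
    by (auto simp: seq_lower_limit_def)
  define q where "q n = fst (fst (P n))" for n
  define qs where "qs n = snd (fst (P n))" for n
  define t where "t n = snd (P n)" for n
  have lim: "q \<longlonglongrightarrow> x" "qs \<longlonglongrightarrow> xs" "t \<longlonglongrightarrow> xs x"
    using tendsto_fst[OF tendsto_fst[OF P(2)]] tendsto_snd[OF tendsto_fst[OF P(2)]] tendsto_snd[OF P(2)]
    unfolding q_def qs_def t_def by simp_all
  have inE: "((q n, qs n), t n) \<in> fitz_epi (S n)" for n using P(1)[of n] by (simp add: q_def qs_def t_def)
  \<comment> \<open>The centres are the epigraph points \<open>(q n, qs n)\<close> and not their
    limit: there the Fitzpatrick inequality bounds the pairing in \<open>gap\<close> by the excess,
    which tends to 0.\<close>
  have "\<exists>y ys. (y, ys) \<in> S n \<and> gap (q n) (qs n) y ys \<le> inverse (real (Suc n))" for n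
    using solv[of n] unfolding near_solvable_def by simp
  then obtain y ys where y: "\<And>n. (y n, ys n) \<in> S n"
      "\<And>n. gap (q n) (qs n) (y n) (ys n) \<le> inverse (real (Suc n))"
    by metis
  have low: "- (t n - qs n (q n)) \<le> (ys n - qs n) (y n - q n)" for n
    using fitz_epiD[OF inE y(1), of n] by (simp add: blinfun.bilinear_simps)
  have "(\<lambda>n. t n - qs n (q n)) \<longlonglongrightarrow> xs x - xs x" by (intro tendsto_diff blinfun.tendsto lim)
  then have d: "(\<lambda>n. t n - qs n (q n)) \<longlonglongrightarrow> 0" by simp
  note diff = gap_tendsto[OF y(2) LIMSEQ_inverse_real_of_nat low d]
  have "y \<longlonglongrightarrow> x" using tendsto_add[OF diff(1) lim(1)] by simp
  moreover have "ys \<longlonglongrightarrow> xs" using tendsto_add[OF diff(2) lim(2)] by simp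
  ultimately show "(x, xs) \<in> lower_limit S" using y(1) by (auto simp: lower_limit_def)
qed

text \<open>Each lower limit is the trace of a closed convex set on the graph of the pairing. Traces
  commute with intersections, so arbitrarily many parameter sequences can be intersected.\<close>

lemma representable_INT_lower_limits:
  fixes S :: "'i \<Rightarrow> nat \<Rightarrow> ('a::banach \<times> 'a dual) set"
  assumes mono: "\<And>i n. i \<in> I \<Longrightarrow> monotone_op (S i n)"
    and solv: "\<And>i n. i \<in> I \<Longrightarrow> near_solvable (S i n)" and I: "I \<noteq> {}"
  shows "representable (\<Inter>i\<in>I. lower_limit (S i))"
proof -
  define E where "E = (\<Inter>i\<in>I. seq_lower_limit (\<lambda>n. fitz_epi (S i n)))"
  have eq: "(\<Inter>i\<in>I. lower_limit (S i)) = {(x, xs). ((x, xs), blinfun_apply xs x) \<in> E}"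
  proof -
    have "(x, xs) \<in> (\<Inter>i\<in>I. lower_limit (S i)) \<longleftrightarrow> ((x, xs), blinfun_apply xs x) \<in> E" for x xs
      unfolding E_def using lower_limit_contact[OF mono solv] by simp
    then show ?thesis by auto
  qed
  show ?thesis
  proof (cases "E = {}")
    case True
    then show ?thesis unfolding eq using representable_empty by simp
  next
    case False
    have ne: "fitz_epi (S i n) \<noteq> {}" if i: "i \<in> I" for i n
    proof -
      obtain y ys where "(y, ys) \<in> S i n" using near_solvable_nonempty[OF solv[OF i, of n]] by auto
      then show ?thesis using pairing_in_fitz_epi[OF mono[OF i]] by blast
    qed
    show ?thesis unfolding eq
    proof (rule representable_of_epigraph[OF _ _ False])
      show "convex E" unfolding E_def by (intro convex_INT convex_seq_lower_limit convex_fitz_epi)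
      show "closed E" unfolding E_def by (intro closed_INT ballI closed_seq_lower_limit ne)
      show "above_pairing E"
        unfolding above_pairing_def
      proof (intro allI impI)
        fix x xs t assume p: "((x, xs), t) \<in> E"
        obtain i where i: "i \<in> I" using I by blast
        obtain P where P: "\<And>n. P n \<in> fitz_epi (S i n)" "P \<longlonglongrightarrow> ((x, xs), t)"
          using p i by (auto simp: E_def seq_lower_limit_def)
        have "snd (fst (P n)) (fst (fst (P n))) \<le> snd (P n)" for n
          using fitz_epi_above_pairing_near_solvable[OF solv[OF i]] P(1)[of n]
          unfolding above_pairing_def by (metis prod.collapse)
        moreover have "(\<lambda>n. blinfun_apply (snd (fst (P n))) (fst (fst (P n)))) \<longlonglongrightarrow> xs x" "(\<lambda>n. snd (P n)) \<longlonglongrightarrow> t"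
          using blinfun.tendsto[OF tendsto_snd[OF tendsto_fst[OF P(2)]] tendsto_fst[OF tendsto_fst[OF P(2)]]]
            tendsto_snd[OF P(2)] by simp_all
        ultimately show "xs x \<le> t" using LIMSEQ_le by blast
      qed
      show "(p, t') \<in> E" if pt: "(p, t) \<in> E" "t \<le> t'" for p t t'
        unfolding E_def
      proof
        fix i assume "i \<in> I"
        then obtain P where P: "\<And>n. P n \<in> fitz_epi (S i n)" "P \<longlonglongrightarrow> (p, t)"
          using pt by (auto simp: E_def seq_lower_limit_def)
        have "(fst (P n), snd (P n) + (t' - t)) \<in> fitz_epi (S i n)" for n
          using P(1)[of n] pt(2) unfolding fitz_epi_def by (fastforce split: prod.splits)
        moreover have "(\<lambda>n. (fst (P n), snd (P n) + (t' - t))) \<longlonglongrightarrow> (fst (p, t), snd (p, t) + (t' - t))"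
          by (intro tendsto_intros P(2))
        ultimately have "(fst (p, t), snd (p, t) + (t' - t)) \<in> seq_lower_limit (\<lambda>n. fitz_epi (S i n))"
          by (rule seq_lower_limitI)
        then show "(p, t') \<in> seq_lower_limit (\<lambda>n. fitz_epi (S i n))" by simp
      qed
    qed
  qed
qed

theorem theorem4p2:
  fixes T1 T2 :: "('a::banach \<times> ('a \<Rightarrow>\<^sub>L real)) set"
  assumes "maximal_monotone T1" and "maximal_monotone T2"
    and "type_D T1" and "type_D T2"
  shows "representable (variational_sum T1 T2)"
proof -
  define I :: "((nat \<Rightarrow> real) \<times> (nat \<Rightarrow> real)) set" where
    "I = {(l, m). (\<forall>n. l n \<ge> 0 \<and> m n \<ge> 0 \<and> l n + m n > 0) \<and> l \<longlonglongrightarrow> 0 \<and> m \<longlonglongrightarrow> 0}"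
  define S where "S = (\<lambda>(l, m) (n :: nat). op_sum (yosida T1 (l n)) (yosida T2 (m n)))"
  have eq: "variational_sum T1 T2 = (\<Inter>i\<in>I. lower_limit (S i))"
    by (auto simp: variational_sum_def I_def S_def)
  have "representable (\<Inter>i\<in>I. lower_limit (S i))"
  proof (rule representable_INT_lower_limits)
    fix i n assume "i \<in> I"
    then obtain l m where i: "i = (l, m)" "l n \<ge> 0" "m n \<ge> 0" "l n + m n > 0" by (auto simp: I_def)
    show "monotone_op (S i n)" "near_solvable (S i n)"
      using yosida_sum_monotone_near_solvable[OF assms(3,4) i(2-4)] by (simp_all add: i(1) S_def)
  next
    have "(\<lambda>n. inverse (real (Suc n)), \<lambda>n. inverse (real (Suc n))) \<in> I"
      using LIMSEQ_inverse_real_of_nat by (simp add: I_def)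
    then show "I \<noteq> {}" by blast
  qed
  then show ?thesis by (simp only: eq)
qed

end
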